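(* Let $d\ge1$ be an integer, let $M>0$, let $\tau>0$ be such that $\tau^2M^2<1$, and let $0<\lambda<\sqrt{1-\tau^2M^2}$. The reservoir kernel map $K^{\rm Volt}:K_M\times K_M\to\mathbb{R}$, $K^{\rm Volt}({\bf z},{\bf z}')=\langle H^{\rm Volt}_\lambda({\bf z}),H^{\rm Volt}_\lambda({\bf z}')\rangle_{T_2(\mathbb{R}^d)}$, of the Volterra reservoir defined using the parameter $\lambda$, $\tau$-tensorization, and with uniformly bounded inputs in $K_M$, is well-defined and can be explicitly calculated for ${\bf z},{\bf z}'\in K_M$ using the recursion $$K^{\rm Volt}({\bf z},{\bf z}')=1+\frac{\lambda^2\,K^{\rm Volt}(T_1({\bf z}),T_1({\bf z}'))}{1-\tau^2\langle p_0({\bf z}),p_0({\bf z}')\rangle},$$ or the expression of its unique solution $$K^{\rm Volt}({\bf z},{\bf z}')=1+\sum_{k=1}^\infty\lambda^{2k}\prod_{j=0}^{k-1}\frac{1}{1-\tau^2\langle{\bf z}_{-j},{\bf z}'_{-j}\rangle}.$$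
   Context: Notation. $\mathbb{Z}_-$ denotes the negative integers including $0$; $\|\cdot\|$ and $\langle\cdot,\cdot\rangle$ are the Euclidean norm and inner product on $\mathbb{R}^d$ and those induced on tensor spaces. $K_M=\{{\bf z}\in(\mathbb{R}^d)^{\mathbb{Z}_-}\mid\|{\bf z}_t\|\le M\text{ for all }t\in\mathbb{Z}_-\}$, a subset of the space $\ell_-^\infty(\mathbb{R}^d)$ of bounded sequences indexed by $\mathbb{Z}_-$. The delay operator $T_1:(\mathbb{R}^d)^{\mathbb{Z}_-}\to(\mathbb{R}^d)^{\mathbb{Z}_-}$ is $T_1({\bf z})_t={\bf z}_{t-1}$, and $p_0({\bf z})={\bf z}_0$. Tensor algebras. For a real inner product space $V$, let $T^0(V)=\mathbb{R}$, let $T^l(V)=V^{\otimes l}$ with the induced inner product determined by $\langle v_1\otimes\cdots\otimes v_l,w_1\otimes\cdots\otimes w_l\rangle=\prod_i\langle v_i,w_i\rangle$, and let $T(V)=\bigoplus_{l\ge0}T^l(V)$ with inner product $\langle\sum_l\mathbf{v}_l,\sum_l\mathbf{w}_l\rangle=\sum_l\langle\mathbf{v}_l,\mathbf{w}_l\rangle$, where $\mathbf{v}_l,\mathbf{w}_l\in T^l(V)$. $\overline{T(V)}$ is the Hilbert space completion. The double tensor algebra is $T_2(\mathbb{R}^d)=\overline{T(\overline{T(\mathbb{R}^d)})}$. $\tau$-tensorization. For ${\bf z}\in\mathbb{R}^d$, $\widetilde{\bf z}=1+\sum_{i=1}^\infty\tau^i\,{\bf z}^{\otimes i}$, where ${\bf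 z}^{\otimes i}\in T^i(\mathbb{R}^d)$; when $\tau^2\|{\bf z}\|^2<1$ this lies in $\overline{T(\mathbb{R}^d)}$. Volterra reservoir. It is the state system $\mathbf{x}_t=\lambda\,\mathbf{x}_{t-1}\otimes\widetilde{\bf z}_t+1$, $t\in\mathbb{Z}_-$, with input ${\bf z}\in K_M$ and states $\mathbf{x}_t\in T_2(\mathbb{R}^d)$. Here $1\in\mathbb{R}=T^0(\overline{T(\mathbb{R}^d)})$, $\otimes$ is the (outer) tensor product of $T_2(\mathbb{R}^d)$, and $\widetilde{\bf z}_t$, the $\tau$-tensorization of ${\bf z}_t$, is regarded as a degree-one element of $T_2(\mathbb{R}^d)$. Under the stated conditions on $\tau$ and $\lambda$, for each ${\bf z}\in K_M$ this system has a unique solution $U^{\rm Volt}_\lambda({\bf z})=(\mathbf{x}_t)_{t\in\mathbb{Z}_-}$, which satisfies $\|\mathbf{x}_t\|\le 1/(1-\lambda/\sqrt{1-\tau^2M^2})$ for all $t\in\mathbb{Z}_-$. The Volterra functional is $H^{\rm Volt}_\lambda({\bf z})=U^{\rm Volt}_\lambda({\bf z})_0\in T_2(\mathbb{R}^d)$.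
   Formalization: Uniqueness of the solution of the recursion is proved among kernels bounded on K_M × K_M; among all real-valued kernels it fails, since nonzero unbounded solutions of the homogeneous recursion exist along non-periodic shift orbits. *)

theory Defs
  imports "HOL-Analysis.Analysis" "HOL-Library.Poly_Mapping"
begin

section \<open>The tensor algebra of a real inner product space\<close>

text \<open>
  Words form a monoid under concatenation, so that the multiplication of \<open>Poly_Mapping\<close> makes
  the finitely supported functions \<open>'a list \<Rightarrow>\<^sub>0 real\<close> the free associative algebra on the
  set \<open>'a\<close>.
\<close>

instantiation list :: (type) monoid_add
begin

definition zero_list :: "'a list" where "zero_list = []"
definition plus_list :: "'a list \<Rightarrow> 'a list \<Rightarrow> 'a list" where "plus_list = (@)"

instance
  by standard (simp_all add: zero_list_def plus_list_def)

end

instantiation poly_mapping :: (type, real_vector) real_vector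
begin

lift_definition scaleR_poly_mapping :: "real \<Rightarrow> ('a \<Rightarrow>\<^sub>0 'b) \<Rightarrow> ('a \<Rightarrow>\<^sub>0 'b)"
  is "\<lambda>c f k. c *\<^sub>R f k"
  by (erule finite_subset[rotated]) auto

instance
  by standard (transfer; simp add: fun_eq_iff scaleR_right_distrib scaleR_left_distrib)+

end

lemma lookup_scaleR: "Poly_Mapping.lookup (c *\<^sub>R x) k = c *\<^sub>R Poly_Mapping.lookup x k"
  by transfer simp

lemma scaleR_single: "c *\<^sub>R Poly_Mapping.single k (a::'b::real_vector) = Poly_Mapping.single k (c *\<^sub>R a)"
  by (rule poly_mapping_eqI) (simp add: lookup_scaleR lookup_single when_def)

lemma scaleR_eq_single_mult:
  fixes x :: "'a list \<Rightarrow>\<^sub>0 real"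
  shows "c *\<^sub>R x = Poly_Mapping.single [] c * x"
proof -
  have "c *\<^sub>R x = Poly_Mapping.map ((*) c) x"
    by (rule poly_mapping_eqI) (simp add: lookup_scaleR Poly_Mapping.map.rep_eq when_def)
  also have "\<dots> = Poly_Mapping.single 0 c * x"
    by (rule mult_map_scale_conv_mult)
  finally show ?thesis by (simp add: zero_list_def)
qed

lemma poly_mapping_expand:
  fixes x :: "'a \<Rightarrow>\<^sub>0 real"
  shows "x = (\<Sum>k\<in>Poly_Mapping.keys x. Poly_Mapping.lookup x k *\<^sub>R Poly_Mapping.single k 1)"
proof (rule poly_mapping_eqI)
  fix k
  have "(\<Sum>k'\<in>Poly_Mapping.keys x. Poly_Mapping.lookup x k' * (if k' = k then 1 else 0))
      = (\<Sum>k'\<in>Poly_Mapping.keys x. if k' = k then Poly_Mapping.lookup x k' else 0)"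
    by (rule sum.cong) auto
  then show "Poly_Mapping.lookup x k
      = Poly_Mapping.lookup (\<Sum>k\<in>Poly_Mapping.keys x. Poly_Mapping.lookup x k *\<^sub>R Poly_Mapping.single k 1) k"
    by (simp add: lookup_sum lookup_scaleR lookup_single when_def in_keys_iff)
qed

lemma span_singles: "span (range (\<lambda>k. Poly_Mapping.single k (1::real))) = UNIV"
proof (intro equalityI subsetI UNIV_I)
  fix x :: "'a \<Rightarrow>\<^sub>0 real"
  show "x \<in> span (range (\<lambda>k. Poly_Mapping.single k 1))"
    by (subst poly_mapping_expand) (intro span_sum span_scale span_base rangeI)
qed

lemma free_induct [case_names zero step]:
  fixes x :: "'a \<Rightarrow>\<^sub>0 real"
  assumes "P 0" "\<And>c k x. P x \<Longrightarrow> P (c *\<^sub>R Poly_Mapping.single k 1 + x)"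
  shows "P x"
proof -
  have "x \<in> span (range (\<lambda>k. Poly_Mapping.single k 1))" by (simp add: span_singles)
  then show ?thesis
    by (induction rule: span_induct_alt) (use assms in auto)
qed

lemma single_append: "Poly_Mapping.single us a * Poly_Mapping.single vs b = Poly_Mapping.single (us @ vs) (a * b)"
  by (simp add: mult_single plus_list_def)

lemma free_scaleR_mult_left:
  fixes x y :: "'a list \<Rightarrow>\<^sub>0 real"
  shows "(c *\<^sub>R x) * y = c *\<^sub>R (x * y)"
  by (simp add: scaleR_eq_single_mult mult.assoc)

lemma free_scaleR_mult_right:
  fixes x y :: "'a list \<Rightarrow>\<^sub>0 real"
  shows "x * (c *\<^sub>R y) = c *\<^sub>R (x * y)"
proof -
  have "x * Poly_Mapping.single [] c = Poly_Mapping.single [] c * x"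
  proof (induction x rule: free_induct)
    case zero show ?case by simp
  next
    case (step b k x)
    then show ?case
      by (simp add: scaleR_single single_append distrib_left distrib_right mult.commute)
  qed
  then show ?thesis by (simp add: scaleR_eq_single_mult flip: mult.assoc)
qed

text \<open>
  \<open>T(V)\<close> is the direct sum over \<open>l\<close> of the tensor powers \<open>T\<^sup>l(V)\<close>, each being the free
  vector space on the words of length \<open>l\<close> modulo multilinearity. Since the relations only
  relate words of equal length, the direct sum may be formed before taking the quotient.
\<close>

definition multilinear_relations :: "('a::real_vector list \<Rightarrow>\<^sub>0 real) set" where
  "multilinear_relations =
     span ({Poly_Mapping.single (us @ (v + w) # vs) 1
              - Poly_Mapping.single (us @ v # vs) 1 - Poly_Mapping.single (us @ w # vs) 1
            | us v w vs. True}
         \<union> {Poly_Mapping.single (us @ (c *\<^sub>R v) # vs) 1 - c *\<^sub>R Poly_Mapping.single (us @ v # vs) 1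
            | us c v vs. True})"

lemma multilinear_relations_add:
  "Poly_Mapping.single (us @ (v + w) # vs) 1
     - Poly_Mapping.single (us @ v # vs) 1 - Poly_Mapping.single (us @ w # vs) 1 \<in> multilinear_relations"
  unfolding multilinear_relations_def by (rule span_base) blast

lemma multilinear_relations_scaleR:
  "Poly_Mapping.single (us @ (c *\<^sub>R v) # vs) 1
     - c *\<^sub>R Poly_Mapping.single (us @ v # vs) 1 \<in> multilinear_relations"
  unfolding multilinear_relations_def by (rule span_base) blast

lemma multilinear_relations_simps [simp, intro]:
  "0 \<in> multilinear_relations"
  "x \<in> multilinear_relations \<Longrightarrow> y \<in> multilinear_relations \<Longrightarrow> x + y \<in> multilinear_relations"
  "x \<in> multilinear_relations \<Longrightarrow> y \<in> multilinear_relations \<Longrightarrow> x - y \<in> multilinear_relations"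
  "x \<in> multilinear_relations \<Longrightarrow> - x \<in> multilinear_relations"
  "x \<in> multilinear_relations \<Longrightarrow> c *\<^sub>R x \<in> multilinear_relations"
  unfolding multilinear_relations_def
  by (blast intro: span_zero span_add span_diff span_neg span_scale)+

lemma multilinear_relations_induct [consumes 1, case_names zero add scaleR]:
  assumes "r \<in> multilinear_relations"
    and "P 0"
    and "\<And>b us v w vs x. P x \<Longrightarrow> P (b *\<^sub>R (Poly_Mapping.single (us @ (v + w) # vs) 1
              - Poly_Mapping.single (us @ v # vs) 1 - Poly_Mapping.single (us @ w # vs) 1) + x)"
    and "\<And>b us c v vs x. P x \<Longrightarrow> P (b *\<^sub>R (Poly_Mapping.single (us @ (c *\<^sub>R v) # vs) 1
              - c *\<^sub>R Poly_Mapping.single (us @ v # vs) 1) + x)"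
  shows "P r"
  using assms(1) unfolding multilinear_relations_def
  by (induction rule: span_induct_alt) (use assms(2-) in blast)+

lemma multilinear_relations_mult_left:
  assumes "r \<in> multilinear_relations"
  shows "x * r \<in> multilinear_relations"
proof (induction x rule: free_induct)
  case zero show ?case by simp
next
  case (step c k x)
  have "Poly_Mapping.single k 1 * r \<in> multilinear_relations"
    using assms
  proof (induction rule: multilinear_relations_induct)
    case zero show ?case by simp
  next
    case (add b us v w vs x)
    show ?case
      using add multilinear_relations_add[of "k @ us" v w vs]
      by (simp add: distrib_left free_scaleR_mult_right right_diff_distrib single_append)
  next
    case (scaleR b us c v vs x)
    show ?case
      using scaleR multilinear_relations_scaleR[of "k @ us" c v vs]
      by (simp add: distrib_left free_scaleR_mult_right right_diff_distrib single_append)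
  qed
  with step show ?case by (simp add: distrib_right free_scaleR_mult_left)
qed

lemma multilinear_relations_mult_right:
  assumes "r \<in> multilinear_relations"
  shows "r * x \<in> multilinear_relations"
proof (induction x rule: free_induct)
  case zero show ?case by simp
next
  case (step c k x)
  have "r * Poly_Mapping.single k 1 \<in> multilinear_relations"
    using assms
  proof (induction rule: multilinear_relations_induct)
    case zero show ?case by simp
  next
    case (add b us v w vs x)
    show ?case
      using add multilinear_relations_add[of us v w "vs @ k"]
      by (simp add: distrib_right free_scaleR_mult_left left_diff_distrib single_append)
  next
    case (scaleR b us c v vs x)
    show ?case
      using scaleR multilinear_relations_scaleR[of us c v "vs @ k"]
      by (simp add: distrib_right free_scaleR_mult_left left_diff_distrib single_append)
  qed
  with step show ?case by (simp add: distrib_left free_scaleR_mult_right)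
qed

lemma multilinear_relations_equivp:
  "equivp (\<lambda>x y. x - y \<in> (multilinear_relations :: ('a::real_vector list \<Rightarrow>\<^sub>0 real) set))"
proof (rule equivpI)
  show "symp (\<lambda>x y :: 'a list \<Rightarrow>\<^sub>0 real. x - y \<in> multilinear_relations)"
    by (rule sympI) (metis minus_diff_eq multilinear_relations_simps(4))
  show "transp (\<lambda>x y :: 'a list \<Rightarrow>\<^sub>0 real. x - y \<in> multilinear_relations)"
  proof (rule transpI)
    fix x y z :: "'a list \<Rightarrow>\<^sub>0 real"
    assume "x - y \<in> multilinear_relations" "y - z \<in> multilinear_relations"
    then have "(x - y) + (y - z) \<in> multilinear_relations"
      by (rule multilinear_relations_simps(2))
    then show "x - z \<in> multilinear_relations" by simp
  qed
qed (simp add: reflp_def)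

quotient_type (overloaded) 'a tensor_algebra = "'a::real_inner list \<Rightarrow>\<^sub>0 real"
  / "\<lambda>x y. x - y \<in> multilinear_relations"
  by (rule multilinear_relations_equivp)


subsection \<open>Inner product\<close>

definition word_inner :: "'a::real_inner list \<Rightarrow> 'a list \<Rightarrow> real" where
  "word_inner vs ws =
     (if length vs = length ws then prod_list (map2 inner vs ws) else 0)"

definition free_inner :: "('a::real_inner list \<Rightarrow>\<^sub>0 real) \<Rightarrow> ('a list \<Rightarrow>\<^sub>0 real) \<Rightarrow> real" where
  "free_inner x y = (\<Sum>vs\<in>Poly_Mapping.keys x. \<Sum>ws\<in>Poly_Mapping.keys y.
     Poly_Mapping.lookup x vs * Poly_Mapping.lookup y ws * word_inner vs ws)"

lemma word_inner_simps [simp]: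
  "word_inner [] [] = 1"
  "word_inner [] (w # ws) = 0"
  "word_inner (v # vs) [] = 0"
  "word_inner (v # vs) (w # ws) = inner v w * word_inner vs ws"
  by (simp_all add: word_inner_def)

lemma word_inner_snoc [simp]:
  "word_inner (vs @ [v]) (ws @ [w]) = word_inner vs ws * inner v w"
  "word_inner [] (ws @ [w]) = 0"
  "word_inner (vs @ [v]) [] = 0"
  by (simp_all add: word_inner_def)

lemma word_inner_commute: "word_inner vs ws = word_inner ws vs"
  by (induction vs ws rule: list_induct2') (simp_all add: inner_commute)

lemma word_inner_add:
  "word_inner (us @ (v + w) # vs) ws = word_inner (us @ v # vs) ws + word_inner (us @ w # vs) ws"
proof (induction us arbitrary: ws)
  case Nil show ?case by (cases ws) (simp_all add: inner_add_left distrib_right)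
next
  case (Cons u us) then show ?case by (cases ws) (simp_all add: distrib_left)
qed

lemma word_inner_scaleR: "word_inner (us @ (c *\<^sub>R v) # vs) ws = c * word_inner (us @ v # vs) ws"
proof (induction us arbitrary: ws)
  case Nil show ?case by (cases ws) simp_all
next
  case (Cons u us) then show ?case by (cases ws) simp_all
qed

lemma free_inner_superset:
  assumes "finite A" "Poly_Mapping.keys x \<subseteq> A" "finite B" "Poly_Mapping.keys y \<subseteq> B"
  shows "free_inner x y = (\<Sum>vs\<in>A. \<Sum>ws\<in>B.
     Poly_Mapping.lookup x vs * Poly_Mapping.lookup y ws * word_inner vs ws)"
proof -
  have "free_inner x y = (\<Sum>vs\<in>Poly_Mapping.keys x. \<Sum>ws\<in>B.
     Poly_Mapping.lookup x vs * Poly_Mapping.lookup y ws * word_inner vs ws)"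
    unfolding free_inner_def
    by (intro sum.cong refl sum.mono_neutral_left assms) (simp add: in_keys_iff)
  also have "\<dots> = (\<Sum>vs\<in>A. \<Sum>ws\<in>B.
     Poly_Mapping.lookup x vs * Poly_Mapping.lookup y ws * word_inner vs ws)"
    by (intro sum.mono_neutral_left assms) (simp add: in_keys_iff)
  finally show ?thesis .
qed

lemma free_inner_commute: "free_inner x y = free_inner y x"
  unfolding free_inner_def
  by (subst sum.swap) (simp add: word_inner_commute mult.commute mult.left_commute)

lemma free_inner_add_left: "free_inner (x + x') y = free_inner x y + free_inner x' y"
proof -
  let ?A = "Poly_Mapping.keys x \<union> Poly_Mapping.keys x'"
  have "free_inner z y = (\<Sum>vs\<in>?A. \<Sum>ws\<in>Poly_Mapping.keys y.
     Poly_Mapping.lookup z vs * Poly_Mapping.lookup y ws * word_inner vs ws)"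
    if "Poly_Mapping.keys z \<subseteq> ?A" for z
    by (rule free_inner_superset) (use that in auto)
  from this[of x] this[of x'] this[of "x + x'"] show ?thesis
    by (simp add: keys_add lookup_add distrib_right sum.distrib)
qed

lemma free_inner_scaleR_left: "free_inner (c *\<^sub>R x) y = c * free_inner x y"
proof -
  have "Poly_Mapping.keys (c *\<^sub>R x) \<subseteq> Poly_Mapping.keys x"
    by (auto simp: in_keys_iff lookup_scaleR)
  then have "free_inner (c *\<^sub>R x) y = (\<Sum>vs\<in>Poly_Mapping.keys x. \<Sum>ws\<in>Poly_Mapping.keys y.
     Poly_Mapping.lookup (c *\<^sub>R x) vs * Poly_Mapping.lookup y ws * word_inner vs ws)"
    by (intro free_inner_superset) auto
  then show ?thesis
    by (simp add: free_inner_def lookup_scaleR sum_distrib_left mult.assoc)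
qed

lemma free_inner_zero [simp]: "free_inner 0 y = 0" "free_inner y 0 = 0"
  by (simp_all add: free_inner_def)

lemma free_inner_uminus_left: "free_inner (- x) y = - free_inner x y"
  using free_inner_scaleR_left[of "-1" x y] by simp

lemma free_inner_diff_left: "free_inner (x - x') y = free_inner x y - free_inner x' y"
  using free_inner_add_left[of x "- x'" y] by (simp add: free_inner_uminus_left)

lemma free_inner_add_right: "free_inner y (x + x') = free_inner y x + free_inner y x'"
  by (metis free_inner_add_left free_inner_commute)

lemma free_inner_scaleR_right: "free_inner y (c *\<^sub>R x) = c * free_inner y x"
  by (metis free_inner_scaleR_left free_inner_commute)

lemma free_inner_diff_right: "free_inner y (x - x') = free_inner y x - free_inner y x'"
  by (metis free_inner_diff_left free_inner_commute)

lemma free_inner_single [simp]: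
  "free_inner (Poly_Mapping.single vs 1) (Poly_Mapping.single ws 1) = word_inner vs ws"
  by (simp add: free_inner_def)

lemma free_inner_multilinear_relations:
  assumes "r \<in> multilinear_relations"
  shows "free_inner r y = 0"
proof (induction y rule: free_induct)
  case zero show ?case by simp
next
  case (step c k y)
  have "free_inner r (Poly_Mapping.single k 1) = 0"
    using assms
    by (induction rule: multilinear_relations_induct)
       (simp_all add: free_inner_add_left free_inner_scaleR_left free_inner_diff_left
          word_inner_add word_inner_scaleR)
  with step show ?case by (simp add: free_inner_add_right free_inner_scaleR_right)
qed

instantiation tensor_algebra :: (real_inner) "{real_vector, ring_1}"
begin

lift_definition zero_tensor_algebra :: "'a tensor_algebra" is 0 .

lift_definition one_tensor_algebra :: "'a tensor_algebra" is 1 .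

lift_definition plus_tensor_algebra :: "'a tensor_algebra \<Rightarrow> 'a tensor_algebra \<Rightarrow> 'a tensor_algebra"
  is "(+)"
  by (drule (1) multilinear_relations_simps(2)) (simp add: algebra_simps)

lift_definition minus_tensor_algebra :: "'a tensor_algebra \<Rightarrow> 'a tensor_algebra \<Rightarrow> 'a tensor_algebra"
  is "(-)"
  by (drule (1) multilinear_relations_simps(3)) (simp add: algebra_simps)

lift_definition uminus_tensor_algebra :: "'a tensor_algebra \<Rightarrow> 'a tensor_algebra"
  is uminus
  by (drule multilinear_relations_simps(4)) (simp add: algebra_simps)

lift_definition scaleR_tensor_algebra :: "real \<Rightarrow> 'a tensor_algebra \<Rightarrow> 'a tensor_algebra"
  is scaleR
  by (drule multilinear_relations_simps(5)) (simp add: scaleR_diff_right)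

lift_definition times_tensor_algebra :: "'a tensor_algebra \<Rightarrow> 'a tensor_algebra \<Rightarrow> 'a tensor_algebra"
  is "(*)"
proof -
  fix x x' y y' :: "'a list \<Rightarrow>\<^sub>0 real"
  assume "x - x' \<in> multilinear_relations" "y - y' \<in> multilinear_relations"
  then have "(x - x') * y + x' * (y - y') \<in> multilinear_relations"
    by (intro multilinear_relations_simps(2) multilinear_relations_mult_left multilinear_relations_mult_right)
  then show "x * y - x' * y' \<in> multilinear_relations"
    by (simp add: algebra_simps)
qed

instance
proof
  show "(0::'a tensor_algebra) \<noteq> 1"
  proof (transfer, rule notI)
    assume "0 - (1::'a list \<Rightarrow>\<^sub>0 real) \<in> multilinear_relations"
    from free_inner_multilinear_relations[OF this, of "Poly_Mapping.single [] 1"]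
    have "free_inner (Poly_Mapping.single ([]::'a list) 1) (Poly_Mapping.single [] 1) = 0"
      by (simp add: free_inner_uminus_left single_one[symmetric] zero_list_def del: single_one free_inner_single)
    then show False by simp
  qed
qed (transfer; simp add: algebra_simps)+

end

instance tensor_algebra :: (real_inner) real_algebra_1
  by standard (transfer; simp add: free_scaleR_mult_left free_scaleR_mult_right)+

text \<open>\<open>pure [v\<^sub>1, \<dots>, v\<^sub>l]\<close> is the elementary tensor \<open>v\<^sub>1 \<otimes> \<dots> \<otimes> v\<^sub>l\<close>.\<close>

lift_definition pure :: "'a::real_inner list \<Rightarrow> 'a tensor_algebra"
  is "\<lambda>vs. Poly_Mapping.single vs 1" .

lemma pure_Nil: "pure [] = 1"
  by transfer (simp add: single_one[symmetric] zero_list_def del: single_one)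

lemma pure_append: "pure (vs @ ws) = pure vs * pure ws"
  by transfer (simp add: single_append)

lemma pure_add: "pure (us @ (v + w) # vs) = pure (us @ v # vs) + pure (us @ w # vs)"
  by transfer (use multilinear_relations_add in \<open>simp add: diff_diff_eq\<close>)

lemma pure_scaleR: "pure (us @ (c *\<^sub>R v) # vs) = c *\<^sub>R pure (us @ v # vs)"
  by transfer (rule multilinear_relations_scaleR)

lemma tensor_algebra_induct [case_names zero step]:
  fixes x :: "'a::real_inner tensor_algebra"
  assumes "P 0" "\<And>c vs x. P x \<Longrightarrow> P (c *\<^sub>R pure vs + x)"
  shows "P x"
proof -
  obtain y where y: "x = abs_tensor_algebra y"
    using Quotient3_abs_rep[OF Quotient3_tensor_algebra, of x] by metis
  have "P (abs_tensor_algebra y)"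
  proof (induction y rule: free_induct)
    case zero
    show ?case using assms(1) by (simp add: zero_tensor_algebra_def)
  next
    case (step c vs y)
    then show ?case
      using assms(2)[of "abs_tensor_algebra y" c vs]
      by (simp add: pure.abs_eq plus_tensor_algebra.abs_eq scaleR_tensor_algebra.abs_eq)
  qed
  then show ?thesis by (simp add: y)
qed

lift_definition tensor_inner :: "'a::real_inner tensor_algebra \<Rightarrow> 'a tensor_algebra \<Rightarrow> real"
  is free_inner
proof -
  fix x x' y y' :: "'a list \<Rightarrow>\<^sub>0 real"
  assume "x - x' \<in> multilinear_relations" "y - y' \<in> multilinear_relations"
  then have "free_inner (x - x') y = 0" "free_inner (y - y') x' = 0"
    by (simp_all add: free_inner_multilinear_relations)
  then have "free_inner x y = free_inner x' y" "free_inner y x' = free_inner y' x'"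
    by (simp_all add: free_inner_diff_left)
  then show "free_inner x y = free_inner x' y'"
    by (metis free_inner_commute)
qed

lemma tensor_inner_commute: "tensor_inner x y = tensor_inner y x"
  by transfer (rule free_inner_commute)

lemma tensor_inner_add_left: "tensor_inner (x + x') y = tensor_inner x y + tensor_inner x' y"
  by transfer (rule free_inner_add_left)

lemma tensor_inner_scaleR_left: "tensor_inner (c *\<^sub>R x) y = c * tensor_inner x y"
  by transfer (rule free_inner_scaleR_left)

lemma tensor_inner_pure: "tensor_inner (pure vs) (pure ws) = word_inner vs ws"
  by transfer simp

lemma tensor_inner_zero_left: "tensor_inner 0 y = 0"
  by transfer simp

lemma tensor_inner_sum_left: "tensor_inner (sum f A) y = (\<Sum>a\<in>A. tensor_inner (f a) y)"
  by (induction A rule: infinite_finite_induct)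
     (simp_all add: tensor_inner_zero_left tensor_inner_add_left)

lemma word_inner_orthogonal:
  assumes "pairwise orthogonal C" "vs \<in> lists C" "ws \<in> lists C" "vs \<noteq> ws"
  shows "word_inner vs ws = 0"
  using assms(2-)
proof (induction vs ws rule: list_induct2')
  case (4 v vs w ws)
  then show ?case
    using assms(1) by (cases "v = w") (auto simp: pairwise_def orthogonal_def)
qed auto

lemma word_inner_self_pos: "0 \<notin> set vs \<Longrightarrow> word_inner vs vs > 0"
  by (induction vs) auto

lemma span_image_linear:
  assumes "x \<in> span A" "linear f" "\<And>a. a \<in> A \<Longrightarrow> f a \<in> span B"
  shows "f x \<in> span B"
  using assms(1)
proof (induction rule: span_induct_alt)
  case base show ?case using linear_0[OF assms(2)] by (simp add: span_zero)
next
  case (step c a y)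
  then show ?case
    by (simp add: linear_add[OF assms(2)] linear_scale[OF assms(2)] span_add span_scale assms(3))
qed

lemma pure_in_span:
  assumes "set vs \<subseteq> span C"
  shows "pure vs \<in> span (pure ` lists C)"
  using assms
proof (induction vs)
  case Nil show ?case by (auto intro: span_base)
next
  case (Cons v vs)
  have *: "pure (c # vs) \<in> span (pure ` lists C)" if "c \<in> C" for c
  proof -
    have "pure [c] * pure vs \<in> span (pure ` lists C)"
    proof (rule span_image_linear[where f = "(*) (pure [c])"])
      show "pure vs \<in> span (pure ` lists C)" using Cons by simp
      show "linear ((*) (pure [c]))"
        by (rule linearI) (simp_all add: distrib_left)
      show "pure [c] * a \<in> span (pure ` lists C)" if "a \<in> pure ` lists C" for a
        using that \<open>c \<in> C\<close> by (auto simp: pure_append[symmetric] intro!: span_base imageI)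
    qed
    then show ?thesis by (simp add: pure_append[symmetric])
  qed
  show ?case
  proof (rule span_image_linear[where f = "\<lambda>v. pure (v # vs)"])
    show "v \<in> span C" using Cons.prems by simp
    show "linear (\<lambda>v. pure (v # vs))"
      using pure_add[of "[]"] pure_scaleR[of "[]"] by (intro linearI) simp_all
  qed (rule *)
qed

lemma tensor_algebra_orthogonal_words:
  fixes x :: "'a::real_inner tensor_algebra"
  obtains C where "finite C" "pairwise orthogonal C" "0 \<notin> C" "x \<in> span (pure ` lists C)"
proof -
  have "\<exists>B::'a set. finite B \<and> x \<in> span (pure ` lists B)"
  proof (induction x rule: tensor_algebra_induct)
    case zero show ?case by (auto intro: span_zero)
  next
    case (step c vs x)
    then obtain B where B: "finite B" "x \<in> span (pure ` lists B)" by blast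
    have "span (pure ` lists B) \<subseteq> span (pure ` lists (B \<union> set vs))"
      by (intro span_mono image_mono lists_mono) auto
    moreover have "pure vs \<in> span (pure ` lists (B \<union> set vs))"
      by (rule pure_in_span) (auto intro: span_base)
    ultimately show ?case
      using B by (intro exI[of _ "B \<union> set vs"]) (auto intro!: span_add span_scale)
  qed
  then obtain B :: "'a set" where B: "finite B" "x \<in> span (pure ` lists B)" by blast
  obtain C where C: "finite C" "span C = span B" "pairwise orthogonal C"
    using basis_orthogonal[OF B(1)] by blast
  have "x \<in> span (pure ` lists (C - {0}))"
  proof (rule span_image_linear[OF B(2), where f = "\<lambda>x. x"])
    show "a \<in> span (pure ` lists (C - {0}))" if "a \<in> pure ` lists B" for a
    proof -
      have "B \<subseteq> span (C - {0})"
        using C(2) span_superset[of B] by (simp add: span_delete_0)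
      then show ?thesis using that by (auto intro!: pure_in_span)
    qed
  qed (simp add: linear_id[unfolded id_def])
  moreover have "pairwise orthogonal (C - {0})"
    using C(3) by (rule pairwise_subset) auto
  ultimately show thesis using C(1) by (intro that[of "C - {0}"]) auto
qed

lemma tensor_inner_pos:
  fixes x :: "'a::real_inner tensor_algebra"
  shows "tensor_inner x x \<ge> 0" and "tensor_inner x x = 0 \<Longrightarrow> x = 0"
proof -
  obtain C :: "'a set" where C: "pairwise orthogonal C" "0 \<notin> C" "x \<in> span (pure ` lists C)"
    using tensor_algebra_orthogonal_words by metis
  obtain t r where t: "finite t" "t \<subseteq> pure ` lists C" and x: "x = (\<Sum>a\<in>t. r a *\<^sub>R a)"
    using C(3) unfolding span_explicit by blast
  have orth: "tensor_inner a b = 0" if ab: "a \<in> t" "b \<in> t" "a \<noteq> b" for a b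
  proof -
    obtain vs ws where "vs \<in> lists C" "ws \<in> lists C" "a = pure vs" "b = pure ws"
      using ab t(2) by blast
    moreover from this \<open>a \<noteq> b\<close> have "vs \<noteq> ws" by blast
    ultimately show ?thesis
      using word_inner_orthogonal[OF C(1)] tensor_inner_pure by metis
  qed
  have pos: "tensor_inner a a > 0" if a: "a \<in> t" for a
  proof -
    obtain vs where vs: "vs \<in> lists C" "a = pure vs"
      using a t(2) by blast
    then have "0 \<notin> set vs" using C(2) by auto
    then show ?thesis using vs(2) by (simp add: tensor_inner_pure word_inner_self_pos)
  qed
  have "tensor_inner x x = (\<Sum>a\<in>t. r a * tensor_inner a x)"
    by (subst (1) x) (simp add: tensor_inner_sum_left tensor_inner_scaleR_left)
  also have "\<dots> = (\<Sum>a\<in>t. r a * (r a * tensor_inner a a))"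
  proof (rule sum.cong)
    fix a assume a: "a \<in> t"
    have "tensor_inner a x = (\<Sum>b\<in>t. r b * tensor_inner b a)"
      by (subst tensor_inner_commute, subst x)
         (simp add: tensor_inner_sum_left tensor_inner_scaleR_left)
    also have "\<dots> = (\<Sum>b\<in>t. if b = a then r b * tensor_inner b a else 0)"
      using a orth by (intro sum.cong) auto
    also have "\<dots> = r a * tensor_inner a a" using a t(1) by simp
    finally show "r a * tensor_inner a x = r a * (r a * tensor_inner a a)" by simp
  qed simp
  also have "\<dots> = (\<Sum>a\<in>t. (r a)\<^sup>2 * tensor_inner a a)"
    by (simp add: power2_eq_square mult.assoc)
  finally have eq: "tensor_inner x x = (\<Sum>a\<in>t. (r a)\<^sup>2 * tensor_inner a a)" .
  have nonneg: "(r a)\<^sup>2 * tensor_inner a a \<ge> 0" if "a \<in> t" for a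
    using pos[OF that] by simp
  show "tensor_inner x x \<ge> 0"
    unfolding eq by (rule sum_nonneg) (rule nonneg)
  assume "tensor_inner x x = 0"
  then have "\<forall>a\<in>t. (r a)\<^sup>2 * tensor_inner a a = 0"
    unfolding eq using t(1) nonneg by (subst (asm) sum_nonneg_eq_0_iff) auto
  then have "r a = 0" if "a \<in> t" for a
    using that pos[OF that] by auto
  then show "x = 0" unfolding x by simp
qed

instantiation tensor_algebra :: (real_inner) real_inner
begin

definition inner_tensor_algebra :: "'a tensor_algebra \<Rightarrow> 'a tensor_algebra \<Rightarrow> real"
  where "inner_tensor_algebra = tensor_inner"

definition norm_tensor_algebra :: "'a tensor_algebra \<Rightarrow> real"
  where "norm_tensor_algebra x = sqrt (inner x x)"

definition dist_tensor_algebra :: "'a tensor_algebra \<Rightarrow> 'a tensor_algebra \<Rightarrow> real"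
  where "dist_tensor_algebra x y = norm (x - y)"

definition sgn_tensor_algebra :: "'a tensor_algebra \<Rightarrow> 'a tensor_algebra"
  where "sgn_tensor_algebra x = x /\<^sub>R norm x"

definition uniformity_tensor_algebra :: "('a tensor_algebra \<times> 'a tensor_algebra) filter"
  where "uniformity_tensor_algebra = (INF e\<in>{0<..}. principal {(x, y). dist x y < e})"

definition open_tensor_algebra :: "'a tensor_algebra set \<Rightarrow> bool"
  where "open_tensor_algebra S \<longleftrightarrow> (\<forall>x\<in>S. \<forall>\<^sub>F (x', y) in uniformity. x' = x \<longrightarrow> y \<in> S)"

instance
proof
  fix x y z :: "'a tensor_algebra" and c :: real
  show "inner x y = inner y x"
    unfolding inner_tensor_algebra_def by (rule tensor_inner_commute)
  show "inner (x + y) z = inner x z + inner y z"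
    unfolding inner_tensor_algebra_def by (rule tensor_inner_add_left)
  show "inner (c *\<^sub>R x) y = c * inner x y"
    unfolding inner_tensor_algebra_def by (rule tensor_inner_scaleR_left)
  show "0 \<le> inner x x"
    unfolding inner_tensor_algebra_def by (rule tensor_inner_pos)
  show "inner x x = 0 \<longleftrightarrow> x = 0"
    unfolding inner_tensor_algebra_def using tensor_inner_pos(2) tensor_inner_zero_left by blast
qed (fact norm_tensor_algebra_def dist_tensor_algebra_def sgn_tensor_algebra_def
      uniformity_tensor_algebra_def open_tensor_algebra_def)+

end

lemma inner_pure: "inner (pure vs) (pure ws) = word_inner vs ws"
  by (simp add: inner_tensor_algebra_def tensor_inner_pure)

lemma inner_mult_pure:
  "inner (x * pure [v]) (y * pure [w]) = inner x y * inner v w"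
proof (induction x rule: tensor_algebra_induct)
  case zero show ?case by simp
next
  case (step c vs x)
  have "inner (pure vs * pure [v]) (y * pure [w]) = inner (pure vs) y * inner v w"
  proof (induction y rule: tensor_algebra_induct)
    case zero show ?case by simp
  next
    case (step c ws y)
    then show ?case
      by (simp add: distrib_right inner_add_right inner_pure flip: pure_append)
  qed
  with step show ?case by (simp add: distrib_right inner_add_left)
qed

lemma norm_mult_pure: "norm (x * pure [v]) = norm x * norm v"
  by (simp add: norm_eq_sqrt_inner inner_mult_pure real_sqrt_mult)

lemma bounded_linear_mult_pure: "bounded_linear (\<lambda>x. x * pure [v])"
  by (rule bounded_linear_intro[where K = "norm v"]) (simp_all add: distrib_right norm_mult_pure)


section \<open>The Hilbert space completion of a real inner product space\<close>

quotient_type (overloaded) 'a hilbert_completion = "nat \<Rightarrow> 'a::real_inner"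
  / partial: "\<lambda>X Y. Cauchy X \<and> Cauchy Y \<and> (\<lambda>n. X n - Y n) \<longlonglongrightarrow> 0"
proof (rule part_equivpI)
  show "\<exists>X::nat \<Rightarrow> 'a. Cauchy X \<and> Cauchy X \<and> (\<lambda>n. X n - X n) \<longlonglongrightarrow> 0"
    by (intro exI[of _ "\<lambda>_. 0"]) (simp add: convergent_Cauchy convergent_const)
  show "symp (\<lambda>X Y :: nat \<Rightarrow> 'a. Cauchy X \<and> Cauchy Y \<and> (\<lambda>n. X n - Y n) \<longlonglongrightarrow> 0)"
  proof (rule sympI, elim conjE, intro conjI)
    fix X Y :: "nat \<Rightarrow> 'a" assume "(\<lambda>n. X n - Y n) \<longlonglongrightarrow> 0"
    from tendsto_minus[OF this] show "(\<lambda>n. Y n - X n) \<longlonglongrightarrow> 0" by simp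
  qed
  show "transp (\<lambda>X Y :: nat \<Rightarrow> 'a. Cauchy X \<and> Cauchy Y \<and> (\<lambda>n. X n - Y n) \<longlonglongrightarrow> 0)"
  proof (rule transpI, elim conjE, intro conjI)
    fix X Y Z :: "nat \<Rightarrow> 'a" assume "(\<lambda>n. X n - Y n) \<longlonglongrightarrow> 0" "(\<lambda>n. Y n - Z n) \<longlonglongrightarrow> 0"
    from tendsto_add[OF this] show "(\<lambda>n. X n - Z n) \<longlonglongrightarrow> 0" by simp
  qed
qed

lemma convergent_norm_Cauchy:
  fixes X :: "nat \<Rightarrow> 'a::real_normed_vector"
  assumes "Cauchy X"
  shows "convergent (\<lambda>n. norm (X n))"
proof (rule real_Cauchy_convergent, rule CauchyI)
  fix e :: real assume "e > 0"
  then obtain N where "\<forall>m\<ge>N. \<forall>n\<ge>N. norm (X m - X n) < e"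
    using CauchyD[OF assms] by blast
  then show "\<exists>N. \<forall>m\<ge>N. \<forall>n\<ge>N. norm (norm (X m) - norm (X n)) < e"
    by (metis norm_triangle_ineq3 order.strict_trans1 real_norm_def)
qed

lemma Cauchy_add:
  fixes X Y :: "nat \<Rightarrow> 'a::real_normed_vector"
  assumes "Cauchy X" "Cauchy Y"
  shows "Cauchy (\<lambda>n. X n + Y n)"
proof (rule CauchyI)
  fix e :: real assume "e > 0"
  then obtain M N where M: "\<forall>m\<ge>M. \<forall>n\<ge>M. norm (X m - X n) < e / 2"
    and N: "\<forall>m\<ge>N. \<forall>n\<ge>N. norm (Y m - Y n) < e / 2"
    using CauchyD[OF assms(1)] CauchyD[OF assms(2)] by (metis half_gt_zero)
  have "norm (X m + Y m - (X n + Y n)) < e" if "m \<ge> max M N" "n \<ge> max M N" for m n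
  proof -
    have "norm (X m + Y m - (X n + Y n)) \<le> norm (X m - X n) + norm (Y m - Y n)"
      by (simp add: norm_diff_triangle_ineq)
    also have "\<dots> < e / 2 + e / 2"
      using that M N by (intro add_strict_mono) auto
    finally show ?thesis by simp
  qed
  then show "\<exists>N. \<forall>m\<ge>N. \<forall>n\<ge>N. norm (X m + Y m - (X n + Y n)) < e" by blast
qed

lemma Cauchy_diff':
  fixes X Y :: "nat \<Rightarrow> 'a::real_normed_vector"
  assumes "Cauchy X" "Cauchy Y"
  shows "Cauchy (\<lambda>n. X n - Y n)"
  using Cauchy_add[OF assms(1) bounded_linear.Cauchy[OF bounded_linear_minus[OF bounded_linear_ident] assms(2)]]
  by simp

lemma convergent_inner_Cauchy:
  fixes X Y :: "nat \<Rightarrow> 'a::real_inner"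
  assumes "Cauchy X" "Cauchy Y"
  shows "convergent (\<lambda>n. inner (X n) (Y n))"
proof -
  have eq: "inner (X n) (Y n) = (norm (X n + Y n) * norm (X n + Y n)
      - norm (X n) * norm (X n) - norm (Y n) * norm (Y n)) * (1/2)" for n
    by (simp add: dot_norm power2_eq_square)
  show ?thesis
    unfolding eq
    by (intro convergent_mult convergent_diff convergent_norm_Cauchy Cauchy_add assms convergent_const)
qed

lemma lim_inner_cong:
  fixes X Y :: "nat \<Rightarrow> 'a::real_inner"
  assumes "Cauchy X" "Cauchy X'" "(\<lambda>n. X n - X' n) \<longlonglongrightarrow> 0"
    and "Cauchy Y" "Cauchy Y'" "(\<lambda>n. Y n - Y' n) \<longlonglongrightarrow> 0"
  shows "lim (\<lambda>n. inner (X n) (Y n)) = lim (\<lambda>n. inner (X' n) (Y' n))"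
proof -
  obtain l where l: "(\<lambda>n. inner (X' n) (Y' n)) \<longlonglongrightarrow> l"
    using convergent_inner_Cauchy[OF assms(2,5)] by (auto simp: convergent_def)
  have "(\<lambda>n. inner (X n - X' n) (Y n)) \<longlonglongrightarrow> 0"
    using bounded_bilinear.Zfun_prod_Bfun[OF bounded_bilinear_inner, of "\<lambda>n. X n - X' n" sequentially Y]
      assms by (simp add: tendsto_Zfun_iff Cauchy_Bseq)
  moreover have "(\<lambda>n. inner (X' n) (Y n - Y' n)) \<longlonglongrightarrow> 0"
    using bounded_bilinear.Bfun_prod_Zfun[OF bounded_bilinear_inner, of X' sequentially "\<lambda>n. Y n - Y' n"]
      assms by (simp add: tendsto_Zfun_iff Cauchy_Bseq)
  ultimately have "(\<lambda>n. inner (X n - X' n) (Y n) + inner (X' n) (Y n - Y' n) + inner (X' n) (Y' n)) \<longlonglongrightarrow> 0 + 0 + l"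
    by (intro tendsto_add l)
  then have "(\<lambda>n. inner (X n) (Y n)) \<longlonglongrightarrow> l"
    by (simp add: inner_diff_left inner_diff_right)
  with l show ?thesis by (simp add: limI)
qed

instantiation hilbert_completion :: (real_inner) real_vector
begin

lift_definition zero_hilbert_completion :: "'a hilbert_completion" is "\<lambda>_. 0"
  by (simp add: convergent_Cauchy convergent_const)

lift_definition plus_hilbert_completion ::
  "'a hilbert_completion \<Rightarrow> 'a hilbert_completion \<Rightarrow> 'a hilbert_completion"
  is "\<lambda>X Y n. X n + Y n"
proof (elim conjE, intro conjI Cauchy_add)
  fix X X' Y Y' :: "nat \<Rightarrow> 'a"
  assume "(\<lambda>n. X n - X' n) \<longlonglongrightarrow> 0" "(\<lambda>n. Y n - Y' n) \<longlonglongrightarrow> 0"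
  from tendsto_add[OF this] show "(\<lambda>n. X n + Y n - (X' n + Y' n)) \<longlonglongrightarrow> 0"
    by (simp add: add_diff_add)
qed

lift_definition uminus_hilbert_completion :: "'a hilbert_completion \<Rightarrow> 'a hilbert_completion"
  is "\<lambda>X n. - X n"
proof (elim conjE, intro conjI bounded_linear.Cauchy[OF bounded_linear_minus[OF bounded_linear_ident]])
  fix X X' :: "nat \<Rightarrow> 'a"
  assume "(\<lambda>n. X n - X' n) \<longlonglongrightarrow> 0"
  from tendsto_minus[OF this] show "(\<lambda>n. - X n - - X' n) \<longlonglongrightarrow> 0" by simp
qed

lift_definition minus_hilbert_completion ::
  "'a hilbert_completion \<Rightarrow> 'a hilbert_completion \<Rightarrow> 'a hilbert_completion"
  is "\<lambda>X Y n. X n - Y n"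
proof (elim conjE, intro conjI Cauchy_diff')
  fix X X' Y Y' :: "nat \<Rightarrow> 'a"
  assume "(\<lambda>n. X n - X' n) \<longlonglongrightarrow> 0" "(\<lambda>n. Y n - Y' n) \<longlonglongrightarrow> 0"
  from tendsto_diff[OF this] show "(\<lambda>n. X n - Y n - (X' n - Y' n)) \<longlonglongrightarrow> 0"
    by (simp add: algebra_simps)
qed

lift_definition scaleR_hilbert_completion :: "real \<Rightarrow> 'a hilbert_completion \<Rightarrow> 'a hilbert_completion"
  is "\<lambda>c X n. c *\<^sub>R X n"
proof (elim conjE, intro conjI bounded_linear.Cauchy[OF bounded_linear_scaleR_right])
  fix c :: real and X X' :: "nat \<Rightarrow> 'a"
  assume "(\<lambda>n. X n - X' n) \<longlonglongrightarrow> 0"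
  from tendsto_scaleR[OF tendsto_const this] show "(\<lambda>n. c *\<^sub>R X n - c *\<^sub>R X' n) \<longlonglongrightarrow> 0"
    by (simp add: scaleR_diff_right)
qed

instance
proof
  fix x y z :: "'a hilbert_completion" and a b :: real
  show "x + y + z = x + (y + z)"
    by transfer (simp add: add.assoc Cauchy_add)
  show "x + y = y + x"
    by transfer (simp add: add.commute Cauchy_add)
  show "0 + x = x"
    by transfer simp
  show "- x + x = 0"
    by transfer (simp add: convergent_Cauchy convergent_const)
  show "x - y = x + - y"
    by transfer (simp add: Cauchy_diff')
  show "a *\<^sub>R (x + y) = a *\<^sub>R x + a *\<^sub>R y"
    by transfer (auto simp: scaleR_add_right
      intro!: Cauchy_add bounded_linear.Cauchy[OF bounded_linear_scaleR_right])
  show "(a + b) *\<^sub>R x = a *\<^sub>R x + b *\<^sub>R x"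
    by transfer (auto simp: scaleR_add_left
      intro!: Cauchy_add bounded_linear.Cauchy[OF bounded_linear_scaleR_right])
  show "a *\<^sub>R b *\<^sub>R x = (a * b) *\<^sub>R x"
    by transfer (auto intro!: bounded_linear.Cauchy[OF bounded_linear_scaleR_right])
  show "1 *\<^sub>R x = x"
    by transfer simp
qed

end

instantiation hilbert_completion :: (real_inner) real_inner
begin

lift_definition inner_hilbert_completion :: "'a hilbert_completion \<Rightarrow> 'a hilbert_completion \<Rightarrow> real"
  is "\<lambda>X Y. lim (\<lambda>n. inner (X n) (Y n))"
  by (blast intro: lim_inner_cong)

definition norm_hilbert_completion :: "'a hilbert_completion \<Rightarrow> real"
  where "norm_hilbert_completion x = sqrt (inner x x)"

definition dist_hilbert_completion :: "'a hilbert_completion \<Rightarrow> 'a hilbert_completion \<Rightarrow> real"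
  where "dist_hilbert_completion x y = norm (x - y)"

definition sgn_hilbert_completion :: "'a hilbert_completion \<Rightarrow> 'a hilbert_completion"
  where "sgn_hilbert_completion x = x /\<^sub>R norm x"

definition uniformity_hilbert_completion :: "('a hilbert_completion \<times> 'a hilbert_completion) filter"
  where "uniformity_hilbert_completion = (INF e\<in>{0<..}. principal {(x, y). dist x y < e})"

definition open_hilbert_completion :: "'a hilbert_completion set \<Rightarrow> bool"
  where "open_hilbert_completion S \<longleftrightarrow> (\<forall>x\<in>S. \<forall>\<^sub>F (x', y) in uniformity. x' = x \<longrightarrow> y \<in> S)"

instance
proof
  fix x y z :: "'a hilbert_completion" and c :: real
  show "inner x y = inner y x"
    by transfer (simp add: inner_commute)
  have L: "(\<lambda>n. inner (X n) (Y n)) \<longlonglongrightarrow> lim (\<lambda>n. inner (X n) (Y n))"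
    if "Cauchy X" "Cauchy Y" for X Y :: "nat \<Rightarrow> 'a"
    using convergent_inner_Cauchy[OF that] by (simp only: convergent_LIMSEQ_iff)
  show "inner (x + y) z = inner x z + inner y z"
    by transfer (simp add: inner_add_left limI[OF tendsto_add[OF L L]])
  show "inner (c *\<^sub>R x) y = c * inner x y"
    by transfer (simp add: limI[OF tendsto_mult_left[OF L]])
  show "0 \<le> inner x x"
  proof transfer
    fix X :: "nat \<Rightarrow> 'a"
    assume "Cauchy X \<and> Cauchy X \<and> (\<lambda>n. X n - X n) \<longlonglongrightarrow> 0"
    then show "0 \<le> lim (\<lambda>n. inner (X n) (X n))"
      by (intro LIMSEQ_le_const[OF L[of X X]]) simp_all
  qed
  show "inner x x = 0 \<longleftrightarrow> x = 0"
  proof transfer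
    fix X :: "nat \<Rightarrow> 'a"
    assume X: "Cauchy X \<and> Cauchy X \<and> (\<lambda>n. X n - X n) \<longlonglongrightarrow> 0"
    have "lim (\<lambda>n. inner (X n) (X n)) = 0 \<longleftrightarrow> (\<lambda>n. inner (X n) (X n)) \<longlonglongrightarrow> 0"
      using L[of X X] X by (metis limI)
    also have "\<dots> \<longleftrightarrow> X \<longlonglongrightarrow> 0"
    proof
      assume "(\<lambda>n. inner (X n) (X n)) \<longlonglongrightarrow> 0"
      from tendsto_real_sqrt[OF this] show "X \<longlonglongrightarrow> 0"
        by (simp add: norm_eq_sqrt_inner[symmetric] tendsto_norm_zero_iff)
    next
      assume "X \<longlonglongrightarrow> 0"
      from tendsto_inner[OF this this] show "(\<lambda>n. inner (X n) (X n)) \<longlonglongrightarrow> 0" by simp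
    qed
    finally show "lim (\<lambda>n. inner (X n) (X n)) = 0 \<longleftrightarrow>
        (Cauchy X \<and> Cauchy (\<lambda>_. 0::'a) \<and> (\<lambda>n. X n - 0) \<longlonglongrightarrow> 0)"
      using X by (simp add: convergent_Cauchy convergent_const)
  qed
qed (fact norm_hilbert_completion_def dist_hilbert_completion_def sgn_hilbert_completion_def
      uniformity_hilbert_completion_def open_hilbert_completion_def)+

end

lift_definition to_completion :: "'a::real_inner \<Rightarrow> 'a hilbert_completion" is "\<lambda>x _. x"
  by (simp add: convergent_Cauchy convergent_const)

lemma to_completion_add: "to_completion (x + y) = to_completion x + to_completion y"
  by transfer (simp add: convergent_Cauchy convergent_const)

lemma to_completion_scaleR: "to_completion (c *\<^sub>R x) = c *\<^sub>R to_completion x"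
  by transfer (simp add: convergent_Cauchy convergent_const)

lemma to_completion_diff: "to_completion (x - y) = to_completion x - to_completion y"
  by transfer (simp add: convergent_Cauchy convergent_const)

lemma inner_to_completion: "inner (to_completion x) (to_completion y) = inner x y"
  by transfer simp

lemma norm_to_completion: "norm (to_completion x) = norm x"
  by (simp add: norm_eq_sqrt_inner inner_to_completion)

lemma to_completion_tendsto_abs:
  fixes X :: "nat \<Rightarrow> 'a::real_inner"
  assumes "Cauchy X"
  shows "(\<lambda>n. to_completion (X n)) \<longlonglongrightarrow> abs_hilbert_completion X"
proof (rule LIMSEQ_I)
  fix e :: real assume "e > 0"
  then obtain N where N: "\<And>m n. m \<ge> N \<Longrightarrow> n \<ge> N \<Longrightarrow> norm (X m - X n) < e / 2"
    using CauchyD[OF assms, of "e / 2"] by auto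
  have "norm (to_completion (X n) - abs_hilbert_completion X) < e" if "n \<ge> N" for n
  proof -
    have C: "Cauchy (\<lambda>m. X n - X m)"
      using assms by (intro Cauchy_diff') (simp_all add: convergent_Cauchy convergent_const)
    have "to_completion (X n) - abs_hilbert_completion X = abs_hilbert_completion (\<lambda>m. X n - X m)"
      using assms by (simp add: to_completion.abs_eq minus_hilbert_completion.abs_eq convergent_Cauchy convergent_const)
    then have "(norm (to_completion (X n) - abs_hilbert_completion X))\<^sup>2
        = lim (\<lambda>m. inner (X n - X m) (X n - X m))"
      using C by (simp add: power2_norm_eq_inner inner_hilbert_completion.abs_eq)
    moreover have "lim (\<lambda>m. inner (X n - X m) (X n - X m)) \<le> (e / 2)\<^sup>2"
    proof (rule LIMSEQ_le_const2)
      show "(\<lambda>m. inner (X n - X m) (X n - X m)) \<longlonglongrightarrow> lim (\<lambda>m. inner (X n - X m) (X n - X m))"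
        using convergent_inner_Cauchy[OF C C] by (simp only: convergent_LIMSEQ_iff)
      show "\<exists>M. \<forall>m\<ge>M. inner (X n - X m) (X n - X m) \<le> (e / 2)\<^sup>2"
      proof (intro exI[of _ N] allI impI)
        fix m assume "m \<ge> N"
        then have "norm (X n - X m) \<le> e / 2" using N[OF that] by (simp add: less_imp_le)
        then have "(norm (X n - X m))\<^sup>2 \<le> (e / 2)\<^sup>2" by (rule power_mono) simp
        then show "inner (X n - X m) (X n - X m) \<le> (e / 2)\<^sup>2"
          by (simp only: power2_norm_eq_inner)
      qed
    qed
    ultimately have "norm (to_completion (X n) - abs_hilbert_completion X) \<le> e / 2"
      using \<open>e > 0\<close> power2_le_imp_le[of _ "e / 2"] by simp
    with \<open>e > 0\<close> show ?thesis by simp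
  qed
  then show "\<exists>N. \<forall>n\<ge>N. norm (to_completion (X n) - abs_hilbert_completion X) < e" by blast
qed

lemma to_completion_approx:
  assumes "e > 0"
  shows "\<exists>v. norm (to_completion v - x) < e"
proof -
  obtain X where "Cauchy X" "x = abs_hilbert_completion X"
    using Quotient3_abs_rep[OF Quotient3_hilbert_completion, of x]
      Quotient3_rep_reflp[OF Quotient3_hilbert_completion, of x] by metis
  then have "(\<lambda>n. to_completion (X n)) \<longlonglongrightarrow> x" by (simp add: to_completion_tendsto_abs)
  from LIMSEQ_D[OF this assms] show ?thesis by auto
qed

lemma closure_range_to_completion: "closure (range to_completion) = UNIV"
proof -
  have "x \<in> closure (range to_completion)" for x :: "'a hilbert_completion"
    unfolding closure_approachable dist_norm using to_completion_approx[of _ x] by auto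
  then show ?thesis by auto
qed

instance hilbert_completion :: (real_inner) complete_space
proof
  fix X :: "nat \<Rightarrow> 'a hilbert_completion"
  assume "Cauchy X"
  have "\<forall>n. \<exists>v. norm (to_completion v - X n) < inverse (real (Suc n))"
    by (intro allI to_completion_approx) simp
  then obtain Y where Y: "\<And>n. norm (to_completion (Y n) - X n) < inverse (real (Suc n))" by metis
  have diff: "(\<lambda>n. to_completion (Y n) - X n) \<longlonglongrightarrow> 0"
    by (rule Lim_null_comparison[OF _ LIMSEQ_inverse_real_of_nat])
       (intro always_eventually allI less_imp_le Y)
  have "Cauchy (\<lambda>n. (to_completion (Y n) - X n) + X n)"
    by (intro Cauchy_add \<open>Cauchy X\<close> LIMSEQ_imp_Cauchy[OF diff])
  then have "Cauchy (\<lambda>n. to_completion (Y n))" by simp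
  then have "Cauchy Y"
    by (simp add: Cauchy_iff norm_to_completion flip: to_completion_diff)
  from tendsto_diff[OF to_completion_tendsto_abs[OF this] diff]
  show "convergent X" by (auto simp: convergent_def)
qed

instance hilbert_completion :: (real_inner) banach ..

text \<open>
  The tensor product on \<open>T(V)\<close> is not bounded, hence does not extend to the whole completion.
  Tensoring with a fixed degree-one element multiplies the norm by a constant, however, and
  therefore extends: \<open>x \<otimes>\<^sub>1 v\<close> is the tensor product of \<open>x\<close> in the completion of \<open>T(V)\<close>
  with \<open>v\<close> in \<open>V = T\<^sup>1(V)\<close>.
\<close>

lift_definition tensor_deg1 ::
  "'a::real_inner tensor_algebra hilbert_completion \<Rightarrow> 'a \<Rightarrow> 'a tensor_algebra hilbert_completion"
  (infixl "\<otimes>\<^sub>1" 70) is "\<lambda>X v n. X n * pure [v]"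
proof (elim conjE, intro conjI)
  fix X X' :: "nat \<Rightarrow> 'a tensor_algebra" and v :: 'a
  assume "Cauchy X" "Cauchy X'" and lim: "(\<lambda>n. X n - X' n) \<longlonglongrightarrow> 0"
  then show "Cauchy (\<lambda>n. X n * pure [v])" "Cauchy (\<lambda>n. X' n * pure [v])"
    by (simp_all add: bounded_linear.Cauchy[OF bounded_linear_mult_pure])
  from bounded_linear.tendsto[OF bounded_linear_mult_pure lim, of v]
  show "(\<lambda>n. X n * pure [v] - X' n * pure [v]) \<longlonglongrightarrow> 0"
    by (simp add: left_diff_distrib)
qed

lemma to_completion_tensor_deg1: "to_completion x \<otimes>\<^sub>1 v = to_completion (x * pure [v])"
  by transfer (simp add: convergent_Cauchy convergent_const)


section \<open>The Volterra reservoir\<close>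

typedef nonpos_int = "{t::int. t \<le> 0}"
  by auto

setup_lifting type_definition_nonpos_int

lift_definition neg :: "nat \<Rightarrow> nonpos_int" is "\<lambda>n. - int n"
  by simp

lift_definition prev :: "nonpos_int \<Rightarrow> nonpos_int" is "\<lambda>t. t - 1"
  by simp

definition bounded_inputs :: "real \<Rightarrow> (nonpos_int \<Rightarrow> 'a::real_normed_vector) set" where
  "bounded_inputs M = {z. \<forall>t. norm (z t) \<le> M}"

definition delay :: "(nonpos_int \<Rightarrow> 'a) \<Rightarrow> nonpos_int \<Rightarrow> 'a" where
  "delay z = (\<lambda>t. z (prev t))"

definition p0 :: "(nonpos_int \<Rightarrow> 'a) \<Rightarrow> 'a" where
  "p0 z = z (neg 0)"

definition tensorization :: "real \<Rightarrow> 'a::real_inner \<Rightarrow> 'a tensor_algebra hilbert_completion" where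
  "tensorization \<tau> z =
     to_completion 1 + suminf (\<lambda>i. \<tau> ^ Suc i *\<^sub>R to_completion (pure (replicate (Suc i) z)))"

lemma tensorization_summable:
  assumes "\<tau>\<^sup>2 * (norm z)\<^sup>2 < 1"
  shows "summable (\<lambda>i. \<tau> ^ Suc i *\<^sub>R to_completion (pure (replicate (Suc i) z)))"
proof (rule summable_norm_cancel)
  have "norm (pure (replicate n z)) = norm z ^ n" for n
  proof (induction n)
    case (Suc n)
    have "pure (replicate (Suc n) z) = pure (replicate n z) * pure [z]"
      by (simp add: replicate_append_same flip: pure_append)
    with Suc show ?case by (simp add: norm_mult_pure mult.commute)
  qed (simp add: norm_eq_sqrt_inner inner_pure)
  then have eq: "norm (\<tau> ^ Suc i *\<^sub>R to_completion (pure (replicate (Suc i) z)))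
      = (\<bar>\<tau>\<bar> * norm z) ^ Suc i" for i
    by (simp only: norm_scaleR norm_to_completion power_abs[symmetric] power_mult_distrib)
  have "(\<bar>\<tau>\<bar> * norm z)\<^sup>2 < 1\<^sup>2" using assms by (simp add: power_mult_distrib)
  then have "\<bar>\<tau>\<bar> * norm z < 1" by (rule power2_less_imp_less) simp
  then have "summable (\<lambda>i. (\<bar>\<tau>\<bar> * norm z) ^ i)" by (intro summable_geometric) simp
  then show "summable (\<lambda>i. norm (\<tau> ^ Suc i *\<^sub>R to_completion (pure (replicate (Suc i) z))))"
    unfolding eq by (subst summable_Suc_iff)
qed

type_synonym 'v double_tensor_algebra =
  "'v tensor_algebra hilbert_completion tensor_algebra hilbert_completion"

definition volterra_system ::
  "real \<Rightarrow> real \<Rightarrow> (nonpos_int \<Rightarrow> 'v::real_inner) \<Rightarrow> (nonpos_int \<Rightarrow> 'v double_tensor_algebra) \<Rightarrow> bool" where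
  "volterra_system \<tau> lam z x \<longleftrightarrow>
     (\<forall>t. x t = lam *\<^sub>R (x (prev t) \<otimes>\<^sub>1 tensorization \<tau> (z t)) + to_completion 1)"

definition volterra_filter ::
  "real \<Rightarrow> real \<Rightarrow> (nonpos_int \<Rightarrow> 'v::real_inner) \<Rightarrow> nonpos_int \<Rightarrow> 'v double_tensor_algebra" where
  "volterra_filter \<tau> lam z = (THE x. volterra_system \<tau> lam z x)"

definition volterra_functional ::
  "real \<Rightarrow> real \<Rightarrow> (nonpos_int \<Rightarrow> 'v::real_inner) \<Rightarrow> 'v double_tensor_algebra" where
  "volterra_functional \<tau> lam z = p0 (volterra_filter \<tau> lam z)"

definition volterra_kernel ::
  "real \<Rightarrow> real \<Rightarrow> (nonpos_int \<Rightarrow> 'v::real_inner) \<Rightarrow> (nonpos_int \<Rightarrow> 'v) \<Rightarrow> real" where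
  "volterra_kernel \<tau> lam z z' = inner (volterra_functional \<tau> lam z) (volterra_functional \<tau> lam z')"

definition volterra_recursion ::
  "real \<Rightarrow> real \<Rightarrow> real \<Rightarrow> ((nonpos_int \<Rightarrow> 'v::real_inner) \<Rightarrow> (nonpos_int \<Rightarrow> 'v) \<Rightarrow> real) \<Rightarrow> bool" where
  "volterra_recursion M \<tau> lam K \<longleftrightarrow>
     (\<forall>z \<in> bounded_inputs M. \<forall>z' \<in> bounded_inputs M.
        K z z' = 1 + lam\<^sup>2 * K (delay z) (delay z') / (1 - \<tau>\<^sup>2 * inner (p0 z) (p0 z')))"

text \<open>
  The recursion also has unbounded solutions (it links only pairs of sequences that are shifts of
  one another), so uniqueness is understood among the kernels that are bounded on the input set.
\<close>

definition bounded_kernel ::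
  "real \<Rightarrow> ((nonpos_int \<Rightarrow> 'v::real_inner) \<Rightarrow> (nonpos_int \<Rightarrow> 'v) \<Rightarrow> real) \<Rightarrow> bool" where
  "bounded_kernel M K \<longleftrightarrow>
     (\<exists>B. \<forall>z \<in> bounded_inputs M. \<forall>z' \<in> bounded_inputs M. \<bar>K z z'\<bar> \<le> B)"

end

(* Tensoring with a degree-one element multiplies inner products and raises the degree, so the
   recursion follows by expanding the inner product of two states in the state equation. A solution
   of the homogeneous system has, at every time, factors of arbitrarily high degree, hence it is
   orthogonal to all words and vanishes; this is why states are unique without any boundedness
   assumption. Solutions exist as geometrically convergent series of iterated tensor products,
   and iterating the recursion determines every bounded kernel. *)

theory Submission
  imports Defs
begin

section \<open>Degree-one tensoring on the completion\<close>

text \<open>\<open>inner_mult_pure\<close> gives the identity termwise along representing Cauchy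
  sequences, and multiplication by the constant \<open>inner v w\<close> commutes with the
  limit.\<close>

lemma inner_tensor_deg1: "inner (x \<otimes>\<^sub>1 v) (y \<otimes>\<^sub>1 w) = inner x y * inner v w"
proof transfer
  fix X Y :: "nat \<Rightarrow> 'a tensor_algebra" and v w :: 'a
  assume "Cauchy X \<and> Cauchy X \<and> (\<lambda>n. X n - X n) \<longlonglongrightarrow> 0"
    and "Cauchy Y \<and> Cauchy Y \<and> (\<lambda>n. Y n - Y n) \<longlonglongrightarrow> 0"
  then have "(\<lambda>n. inner (X n) (Y n)) \<longlonglongrightarrow> lim (\<lambda>n. inner (X n) (Y n))"
    using convergent_inner_Cauchy[of X Y] by (simp only: convergent_LIMSEQ_iff)
  from tendsto_mult_right[OF this, of "inner v w"]
  show "lim (\<lambda>n. inner (X n * pure [v]) (Y n * pure [w])) = lim (\<lambda>n. inner (X n) (Y n)) * inner v w"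
    by (simp add: inner_mult_pure limI)
qed

lemma norm_tensor_deg1: "norm (x \<otimes>\<^sub>1 v) = norm x * norm v"
  by (simp add: norm_eq_sqrt_inner inner_tensor_deg1 real_sqrt_mult)

lemma bounded_linear_tensor_deg1: "bounded_linear (\<lambda>x. x \<otimes>\<^sub>1 v)"
proof (rule bounded_linear_intro[where K = "norm v"])
  show "(x + y) \<otimes>\<^sub>1 v = x \<otimes>\<^sub>1 v + y \<otimes>\<^sub>1 v" for x y
    by transfer (auto simp: distrib_right
      intro!: Cauchy_add bounded_linear.Cauchy[OF bounded_linear_mult_pure])
  show "(c *\<^sub>R x) \<otimes>\<^sub>1 v = c *\<^sub>R (x \<otimes>\<^sub>1 v)" for c x
    by transfer (auto intro!: bounded_linear.Cauchy[OF bounded_linear_mult_pure]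
      bounded_linear.Cauchy[OF bounded_linear_scaleR_right])
qed (simp add: norm_tensor_deg1)

lemma to_completion_zero: "to_completion 0 = 0"
  using to_completion_scaleR[of 0 0] by simp

lemma inner_tensor_algebra_one: "inner (1 :: 'a::real_inner tensor_algebra) 1 = 1"
  using inner_pure[of "[] :: 'a list" "[]"] by (simp add: pure_Nil)

text \<open>Density argument: the zero set of a continuous map is closed, and here it contains the
  dense image of \<open>to_completion\<close>.\<close>

lemma bounded_linear_completion_eq_0:
  fixes f :: "'a::real_inner hilbert_completion \<Rightarrow> 'b::real_normed_vector"
  assumes "bounded_linear f" and "\<And>v. f (to_completion v) = 0"
  shows "f x = 0"
proof -
  have "closed {x. f x = 0}"
    by (intro closed_Collect_eq continuous_on_const linear_continuous_on assms(1))
  then have "closure (range to_completion) \<subseteq> {x. f x = 0}"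
    using assms(2) by (intro closure_minimal) auto
  then show ?thesis by (auto simp: closure_range_to_completion)
qed

text \<open>A word ending in \<open>v\<close> has length at least one, hence is orthogonal to the
  empty word, which is 1. Linearity and density carry this over to the whole completion.\<close>

lemma inner_tensor_deg1_one: "inner (x \<otimes>\<^sub>1 v) (to_completion 1) = 0"
proof (rule bounded_linear_completion_eq_0[where f = "\<lambda>x. inner (x \<otimes>\<^sub>1 v) (to_completion 1)"])
  show "bounded_linear (\<lambda>x. inner (x \<otimes>\<^sub>1 v) (to_completion 1))"
    by (rule bounded_linear_compose[OF bounded_linear_inner_left bounded_linear_tensor_deg1])
  show "inner (to_completion y \<otimes>\<^sub>1 v) (to_completion 1) = 0" for y
  proof (induction y rule: tensor_algebra_induct)
    case zero
    show ?case by (simp add: to_completion_zero linear_0[OF bounded_linear.linear[OF bounded_linear_tensor_deg1]])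
  next
    case (step c vs y)
    have "inner (pure vs * pure [v]) 1 = 0"
      by (simp add: inner_pure flip: pure_append pure_Nil)
    with step show ?case
      by (simp add: to_completion_tensor_deg1 inner_to_completion distrib_right inner_add_left)
  qed
qed

section \<open>Uniqueness of states\<close>

text \<open>Words span the tensor algebra, whose image is dense, so \<open>x\<close> is orthogonal
  to everything and in particular to itself.\<close>

lemma completed_tensor_algebra_eq_0I:
  assumes words: "\<And>vs. inner x (to_completion (pure vs)) = 0"
  shows "x = 0"
proof -
  have "inner x (to_completion y) = 0" for y
  proof (induction y rule: tensor_algebra_induct)
    case zero
    show ?case by (simp add: to_completion_zero)
  qed (simp add: words to_completion_add to_completion_scaleR inner_add_right)
  then have "inner x x = 0"
    by (rule bounded_linear_completion_eq_0[OF bounded_linear_inner_right])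
  then show ?thesis by simp
qed

lemma homogeneous_volterra_system:
  fixes y :: "nonpos_int \<Rightarrow> 'a::real_inner tensor_algebra hilbert_completion"
  assumes y: "\<And>t. y t = lam *\<^sub>R (y (prev t) \<otimes>\<^sub>1 v t)"
  shows "y t = 0"
proof (rule completed_tensor_algebra_eq_0I)
  fix ws
  show "inner (y t) (to_completion (pure ws)) = 0"
  \<comment> \<open>Each use of the equation strips the last letter of the word and moves one step
    into the past, so \<open>t\<close> has to vary. At the empty word the remaining factor of degree
    one forces the value 0.\<close>
  proof (induction ws arbitrary: t rule: rev_induct)
    case Nil
    show ?case by (subst y) (simp add: pure_Nil inner_tensor_deg1_one)
  next
    case (snoc w ws)
    then show ?case
      by (subst y) (simp add: pure_append inner_tensor_deg1 flip: to_completion_tensor_deg1)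
  qed
qed

text \<open>The constant 1 cancels in the difference of two solutions, which therefore solves the
  homogeneous system.\<close>

lemma volterra_system_unique:
  assumes "volterra_system \<tau> lam z x" "volterra_system \<tau> lam z x'"
  shows "x = x'"
proof
  fix t
  interpret T: bounded_linear "\<lambda>x. x \<otimes>\<^sub>1 v" for v :: "'a tensor_algebra hilbert_completion"
    by (rule bounded_linear_tensor_deg1)
  have "x t - x' t = 0"
  proof (rule homogeneous_volterra_system)
    fix t
    have "x t = lam *\<^sub>R (x (prev t) \<otimes>\<^sub>1 tensorization \<tau> (z t)) + to_completion 1"
      "x' t = lam *\<^sub>R (x' (prev t) \<otimes>\<^sub>1 tensorization \<tau> (z t)) + to_completion 1"
      using assms unfolding volterra_system_def by blast+
    then show "x t - x' t = lam *\<^sub>R ((x (prev t) - x' (prev t)) \<otimes>\<^sub>1 tensorization \<tau> (z t))"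
      by (simp add: T.diff scaleR_diff_right)
  qed
  then show "x t = x' t" by simp
qed

section \<open>Inner products of tensorizations\<close>

lemma inner_pure_replicate:
  "inner (pure (replicate i z)) (pure (replicate j w)) = (if i = j then inner z w ^ i else 0)"
proof -
  have "word_inner (replicate i z) (replicate i w) = inner z w ^ i"
    by (induction i) simp_all
  then show ?thesis by (simp add: inner_pure word_inner_def)
qed

text \<open>Absorbs the separate constant term of \<open>tensorization\<close> as index 0, so that
  one power series can be expanded under the inner product.\<close>

lemma tensorization_sums:
  assumes "\<tau>\<^sup>2 * (norm z)\<^sup>2 < 1"
  shows "(\<lambda>i. \<tau> ^ i *\<^sub>R to_completion (pure (replicate i z))) sums tensorization \<tau> z"
proof -
  let ?f = "\<lambda>i. \<tau> ^ i *\<^sub>R to_completion (pure (replicate i z))"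
  have "(\<lambda>i. ?f (Suc i)) sums suminf (\<lambda>i. ?f (Suc i))"
    using tensorization_summable[OF assms] by (rule summable_sums)
  then have "?f sums (suminf (\<lambda>i. ?f (Suc i)) + ?f 0)"
    by (rule sums_Suc[where f = ?f])
  then show ?thesis by (simp add: tensorization_def pure_Nil add.commute)
qed

text \<open>Tensor powers of different degree are orthogonal. Expanding first one argument and then
  the other leaves only the diagonal, a geometric series with ratio
  \<open>\<tau>\<^sup>2 * inner z w\<close>.\<close>

lemma inner_tensorization:
  assumes z: "\<tau>\<^sup>2 * (norm z)\<^sup>2 < 1" and w: "\<tau>\<^sup>2 * (norm w)\<^sup>2 < 1"
  shows "inner (tensorization \<tau> z) (tensorization \<tau> w) = 1 / (1 - \<tau>\<^sup>2 * inner z w)"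
proof -
  have coeff: "inner (tensorization \<tau> z) (to_completion (pure (replicate j w))) = \<tau> ^ j * inner z w ^ j" for j
  proof (rule sums_unique2)
    show "(\<lambda>i. inner (\<tau> ^ i *\<^sub>R to_completion (pure (replicate i z))) (to_completion (pure (replicate j w))))
        sums inner (tensorization \<tau> z) (to_completion (pure (replicate j w)))"
      by (rule bounded_linear.sums[OF bounded_linear_inner_left tensorization_sums[OF z]])
    show "(\<lambda>i. inner (\<tau> ^ i *\<^sub>R to_completion (pure (replicate i z))) (to_completion (pure (replicate j w))))
        sums (\<tau> ^ j * inner z w ^ j)"
      using sums_single[of j "\<lambda>i. \<tau> ^ i * inner z w ^ i"]
      by (simp add: inner_to_completion inner_pure_replicate if_distrib[of "(*) _"] cong: if_cong)
  qed
  have "(\<lambda>j. inner (tensorization \<tau> z) (\<tau> ^ j *\<^sub>R to_completion (pure (replicate j w))))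
      sums inner (tensorization \<tau> z) (tensorization \<tau> w)"
    by (rule bounded_linear.sums[OF bounded_linear_inner_right tensorization_sums[OF w]])
  moreover have "inner (tensorization \<tau> z) (\<tau> ^ j *\<^sub>R to_completion (pure (replicate j w)))
      = (\<tau>\<^sup>2 * inner z w) ^ j" for j
    by (simp add: coeff power_mult_distrib power2_eq_square)
  \<comment> \<open>Cauchy-Schwarz and the inequality of arithmetic and geometric means bound twice
    the ratio by the sum of the left-hand sides of the two hypotheses.\<close>
  moreover have "\<bar>\<tau>\<^sup>2 * inner z w\<bar> < 1"
  proof -
    have "\<bar>inner z w\<bar> \<le> norm z * norm w" by (rule Cauchy_Schwarz_ineq2)
    then have "2 * \<bar>inner z w\<bar> \<le> (norm z)\<^sup>2 + (norm w)\<^sup>2"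
      using sum_squares_bound[of "norm z" "norm w"] by linarith
    from mult_left_mono[OF this, of "\<tau>\<^sup>2"]
    have "2 * (\<tau>\<^sup>2 * \<bar>inner z w\<bar>) \<le> \<tau>\<^sup>2 * (norm z)\<^sup>2 + \<tau>\<^sup>2 * (norm w)\<^sup>2"
      by (simp add: algebra_simps)
    then show ?thesis using z w by (simp add: abs_mult)
  qed
  ultimately show ?thesis
    using geometric_sums[of "\<tau>\<^sup>2 * inner z w"] by (simp add: sums_unique2)
qed

section \<open>Bounded inputs and their delays\<close>

lemma bounded_inputs_inner_le:
  assumes "z \<in> bounded_inputs M" "z' \<in> bounded_inputs M"
  shows "\<tau>\<^sup>2 * inner (z t) (z' s) \<le> \<tau>\<^sup>2 * M\<^sup>2"
proof -
  have "norm (z t) \<le> M" "norm (z' s) \<le> M"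
    using assms by (auto simp: bounded_inputs_def)
  then have "norm (z t) * norm (z' s) \<le> M * M"
    by (intro mult_mono) (auto intro: order_trans[OF norm_ge_zero])
  then have "inner (z t) (z' s) \<le> M\<^sup>2"
    using norm_cauchy_schwarz[of "z t" "z' s"] by (simp add: power2_eq_square)
  then show ?thesis by (simp add: mult_left_mono)
qed

lemma bounded_inputs_norm_less:
  fixes z :: "nonpos_int \<Rightarrow> 'v::real_inner"
  assumes "z \<in> bounded_inputs M" "\<tau>\<^sup>2 * M\<^sup>2 < 1"
  shows "\<tau>\<^sup>2 * (norm (z t))\<^sup>2 < 1"
  using bounded_inputs_inner_le[OF assms(1,1), of \<tau> t t] assms(2)
  by (simp add: power2_norm_eq_inner)

lemma delay_bounded_inputs: "z \<in> bounded_inputs M \<Longrightarrow> delay z \<in> bounded_inputs M"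
  by (simp add: bounded_inputs_def delay_def)

lemma funpow_delay_bounded_inputs: "z \<in> bounded_inputs M \<Longrightarrow> (delay ^^ n) z \<in> bounded_inputs M"
  by (induction n) (simp_all add: delay_bounded_inputs)

lemma prev_neg: "prev (neg n) = neg (Suc n)"
  by transfer simp

lemma p0_funpow_delay: "p0 ((delay ^^ n) z) = z (neg n)"
proof -
  \<comment> \<open>Generalized from time 0 to \<open>neg m\<close>, since every delay shifts the
    time of evaluation.\<close>
  have "(delay ^^ n) z (neg m) = z (neg (m + n))" for m
    by (induction n arbitrary: m) (simp_all add: delay_def prev_neg)
  then show ?thesis by (simp add: p0_def)
qed

section \<open>Existence of states\<close>

lemma norm_tensorization_le:
  assumes z: "z \<in> bounded_inputs M" and "\<tau>\<^sup>2 * M\<^sup>2 < 1"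
  shows "norm (tensorization \<tau> (z t)) \<le> 1 / sqrt (1 - \<tau>\<^sup>2 * M\<^sup>2)"
proof -
  have "\<tau>\<^sup>2 * (norm (z t))\<^sup>2 < 1" by (rule bounded_inputs_norm_less[OF assms])
  then have "norm (tensorization \<tau> (z t)) = 1 / sqrt (1 - \<tau>\<^sup>2 * inner (z t) (z t))"
    by (simp add: norm_eq_sqrt_inner inner_tensorization real_sqrt_divide)
  also have "\<dots> \<le> 1 / sqrt (1 - \<tau>\<^sup>2 * M\<^sup>2)"
    using bounded_inputs_inner_le[OF z z, of \<tau> t t] assms(2)
    by (intro divide_left_mono) (auto intro!: mult_pos_pos)
  finally show ?thesis .
qed

text \<open>The terms of the Neumann series of the state equation: at time t, the k-th one is
  \<open>lam ^ k\<close> times the tensor product of the tensorized inputs at times t-k+1 to t, in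
  this order.\<close>

fun volterra_term ::
  "real \<Rightarrow> real \<Rightarrow> (nonpos_int \<Rightarrow> 'v::real_inner) \<Rightarrow> nat \<Rightarrow> nonpos_int \<Rightarrow> 'v double_tensor_algebra" where
  "volterra_term \<tau> lam z 0 t = to_completion 1"
| "volterra_term \<tau> lam z (Suc k) t =
     lam *\<^sub>R (volterra_term \<tau> lam z k (prev t) \<otimes>\<^sub>1 tensorization \<tau> (z t))"

lemma norm_volterra_term_le:
  assumes "z \<in> bounded_inputs M" "\<tau>\<^sup>2 * M\<^sup>2 < 1" "0 < lam"
  shows "norm (volterra_term \<tau> lam z k t) \<le> (lam / sqrt (1 - \<tau>\<^sup>2 * M\<^sup>2)) ^ k"
proof (induction k arbitrary: t)
  case 0
  show ?case by (simp add: norm_eq_sqrt_inner inner_to_completion inner_tensor_algebra_one)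
next
  case (Suc k)
  have "norm (volterra_term \<tau> lam z (Suc k) t)
      = lam * (norm (volterra_term \<tau> lam z k (prev t)) * norm (tensorization \<tau> (z t)))"
    using assms(3) by (simp add: norm_tensor_deg1)
  also have "\<dots> \<le> lam * ((lam / sqrt (1 - \<tau>\<^sup>2 * M\<^sup>2)) ^ k * (1 / sqrt (1 - \<tau>\<^sup>2 * M\<^sup>2)))"
    using assms by (intro mult_left_mono mult_mono Suc norm_tensorization_le) auto
  also have "\<dots> = (lam / sqrt (1 - \<tau>\<^sup>2 * M\<^sup>2)) ^ Suc k" by simp
  finally show ?case .
qed

text \<open>The Neumann series is dominated by a geometric series with ratio
  \<open>lam / sqrt (1 - \<tau>\<^sup>2 * M\<^sup>2)\<close>, which is less than 1. This yields
  convergence and the bound on the states together.\<close>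

lemma volterra_system_exists:
  fixes z :: "nonpos_int \<Rightarrow> 'v::real_inner"
  assumes z: "z \<in> bounded_inputs M"
    and par: "\<tau>\<^sup>2 * M\<^sup>2 < 1" "0 < lam" "lam < sqrt (1 - \<tau>\<^sup>2 * M\<^sup>2)"
  obtains x where "volterra_system \<tau> lam z x"
    and "\<And>t. norm (x t) \<le> 1 / (1 - lam / sqrt (1 - \<tau>\<^sup>2 * M\<^sup>2))"
proof
  define r where "r = lam / sqrt (1 - \<tau>\<^sup>2 * M\<^sup>2)"
  let ?P = "volterra_term \<tau> lam z"
  have r: "0 \<le> r" "r < 1" using par by (simp_all add: r_def)
  have le: "norm (?P k t) \<le> r ^ k" for k t
    unfolding r_def by (rule norm_volterra_term_le[OF z par(1,2)])
  have geo: "summable (\<lambda>k. r ^ k)" using r by (simp add: summable_geometric)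
  have sm: "summable (\<lambda>k. ?P k t)" for t
    by (rule summable_comparison_test'[OF geo, of 0]) (rule le)
  show "volterra_system \<tau> lam z (\<lambda>t. suminf (\<lambda>k. ?P k t))"
    unfolding volterra_system_def
  proof
    fix t
    have "(\<lambda>k. ?P k (prev t) \<otimes>\<^sub>1 tensorization \<tau> (z t))
        sums (suminf (\<lambda>k. ?P k (prev t)) \<otimes>\<^sub>1 tensorization \<tau> (z t))"
      by (intro bounded_linear.sums[OF bounded_linear_tensor_deg1] summable_sums sm)
    from sums_scaleR_right[OF this, of lam]
    have "(\<lambda>k. ?P (Suc k) t) sums (lam *\<^sub>R (suminf (\<lambda>k. ?P k (prev t)) \<otimes>\<^sub>1 tensorization \<tau> (z t)))"
      by simp
    \<comment> \<open>The linear part of the state equation shifts the series by one index;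
      restoring the term at index 0 supplies the constant 1.\<close>
    from sums_Suc[OF this]
    show "suminf (\<lambda>k. ?P k t)
        = lam *\<^sub>R (suminf (\<lambda>k. ?P k (prev t)) \<otimes>\<^sub>1 tensorization \<tau> (z t)) + to_completion 1"
      by (simp add: sums_iff)
  qed
  show "norm (suminf (\<lambda>k. ?P k t)) \<le> 1 / (1 - lam / sqrt (1 - \<tau>\<^sup>2 * M\<^sup>2))" for t
  proof -
    have "norm (suminf (\<lambda>k. ?P k t)) \<le> suminf (\<lambda>k. r ^ k)"
      by (rule norm_suminf_le[OF le geo])
    then show ?thesis using r by (simp add: suminf_geometric r_def)
  qed
qed

section \<open>The kernel and its recursion\<close>

text \<open>Together with uniqueness, this identifies the functional of the delayed input with the
  state at time -1.\<close>

lemma volterra_system_delay: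
  "volterra_system \<tau> lam z x \<Longrightarrow> volterra_system \<tau> lam (delay z) (delay x)"
  unfolding volterra_system_def delay_def by blast

lemma volterra_filter_eq: "volterra_system \<tau> lam z x \<Longrightarrow> volterra_filter \<tau> lam z = x"
  unfolding volterra_filter_def by (blast intro: volterra_system_unique)

lemma volterra_functional_eq: "volterra_system \<tau> lam z x \<Longrightarrow> volterra_functional \<tau> lam z = x (neg 0)"
  by (simp add: volterra_functional_def volterra_filter_eq p0_def)

text \<open>The bound on the states is uniform over the input set, so Cauchy-Schwarz bounds the
  kernel by its square.\<close>

lemma volterra_kernel_bounded:
  fixes M :: real
  assumes par: "\<tau>\<^sup>2 * M\<^sup>2 < 1" "0 < lam" "lam < sqrt (1 - \<tau>\<^sup>2 * M\<^sup>2)"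
  shows "bounded_kernel M (volterra_kernel \<tau> lam :: (nonpos_int \<Rightarrow> 'v::real_inner) \<Rightarrow> _)"
  unfolding bounded_kernel_def
proof (intro exI ballI)
  define B where "B = 1 / (1 - lam / sqrt (1 - \<tau>\<^sup>2 * M\<^sup>2))"
  have B: "norm (volterra_functional \<tau> lam z) \<le> B"
    if "z \<in> bounded_inputs M" for z :: "nonpos_int \<Rightarrow> 'v"
    by (rule volterra_system_exists[OF that par]) (simp add: volterra_functional_eq B_def)
  fix z z' :: "nonpos_int \<Rightarrow> 'v"
  assume zz': "z \<in> bounded_inputs M" "z' \<in> bounded_inputs M"
  have "\<bar>volterra_kernel \<tau> lam z z'\<bar> \<le> norm (volterra_functional \<tau> lam z) * norm (volterra_functional \<tau> lam z')"
    unfolding volterra_kernel_def by (rule Cauchy_Schwarz_ineq2)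
  also have "\<dots> \<le> B * B"
    using B[OF zz'(1)] B[OF zz'(2)] by (intro mult_mono) (auto intro: order_trans[OF norm_ge_zero])
  finally show "\<bar>volterra_kernel \<tau> lam z z'\<bar> \<le> B * B" .
qed

lemma volterra_kernel_recursion:
  fixes M :: real
  assumes par: "\<tau>\<^sup>2 * M\<^sup>2 < 1" "0 < lam" "lam < sqrt (1 - \<tau>\<^sup>2 * M\<^sup>2)"
  shows "volterra_recursion M \<tau> lam (volterra_kernel \<tau> lam :: (nonpos_int \<Rightarrow> 'v::real_inner) \<Rightarrow> _)"
  unfolding volterra_recursion_def
proof (intro ballI)
  fix z z' :: "nonpos_int \<Rightarrow> 'v"
  assume z: "z \<in> bounded_inputs M" and z': "z' \<in> bounded_inputs M"
  obtain x where x: "volterra_system \<tau> lam z x" using volterra_system_exists[OF z par] by blast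
  obtain x' where x': "volterra_system \<tau> lam z' x'" using volterra_system_exists[OF z' par] by blast
  let ?t = "neg 0"
  have "volterra_kernel \<tau> lam z z' = inner (x ?t) (x' ?t)"
    using x x' by (simp add: volterra_kernel_def volterra_functional_eq)
  also have "\<dots> = inner (lam *\<^sub>R (x (prev ?t) \<otimes>\<^sub>1 tensorization \<tau> (z ?t)) + to_completion 1)
      (lam *\<^sub>R (x' (prev ?t) \<otimes>\<^sub>1 tensorization \<tau> (z' ?t)) + to_completion 1)"
    using x[unfolded volterra_system_def, rule_format, of ?t]
      x'[unfolded volterra_system_def, rule_format, of ?t] by (simp only:)
  \<comment> \<open>The cross terms vanish by \<open>inner_tensor_deg1_one\<close>, and the product
    of the two degree-one tensorings factorizes.\<close>
  also have "\<dots> = 1 + lam\<^sup>2 * (inner (x (prev ?t)) (x' (prev ?t))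
      * inner (tensorization \<tau> (z ?t)) (tensorization \<tau> (z' ?t)))"
    by (simp add: inner_add_left inner_add_right inner_tensor_deg1 inner_tensor_deg1_one
        inner_commute[of "to_completion 1" "_ \<otimes>\<^sub>1 _"] inner_to_completion power2_eq_square
        inner_tensor_algebra_one)
  also have "inner (tensorization \<tau> (z ?t)) (tensorization \<tau> (z' ?t)) = 1 / (1 - \<tau>\<^sup>2 * inner (p0 z) (p0 z'))"
    using bounded_inputs_norm_less[OF z par(1)] bounded_inputs_norm_less[OF z' par(1)]
    by (simp add: inner_tensorization p0_def)
  also have "inner (x (prev ?t)) (x' (prev ?t)) = volterra_kernel \<tau> lam (delay z) (delay z')"
    using volterra_functional_eq[OF volterra_system_delay[OF x]]
      volterra_functional_eq[OF volterra_system_delay[OF x']]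
    by (simp add: volterra_kernel_def delay_def)
  finally show "volterra_kernel \<tau> lam z z'
      = 1 + lam\<^sup>2 * volterra_kernel \<tau> lam (delay z) (delay z') / (1 - \<tau>\<^sup>2 * inner (p0 z) (p0 z'))"
    by simp
qed

section \<open>Solving the recursion\<close>

text \<open>Stated for an arbitrary bounded solution \<open>K\<close>, so that it gives both the
  series for the Volterra kernel and the uniqueness of the solution.\<close>

lemma bounded_volterra_recursion_sums:
  fixes z z' :: "nonpos_int \<Rightarrow> 'v::real_inner"
  assumes par: "\<tau>\<^sup>2 * M\<^sup>2 < 1" "0 < lam" "lam < sqrt (1 - \<tau>\<^sup>2 * M\<^sup>2)"
    and K: "bounded_kernel M K" "volterra_recursion M \<tau> lam K"
    and z: "z \<in> bounded_inputs M" and z': "z' \<in> bounded_inputs M"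
  shows "(\<lambda>k. lam ^ (2 * Suc k) * (\<Prod>j<Suc k. 1 / (1 - \<tau>\<^sup>2 * inner (z (neg j)) (z' (neg j)))))
    sums (K z z' - 1)"
proof -
  \<comment> \<open>Includes the index 0, where the empty product gives \<open>a 0 = 1\<close>, the
    leading 1 of the series.\<close>
  define a where "a k = lam ^ (2 * k) * (\<Prod>j<k. 1 / (1 - \<tau>\<^sup>2 * inner (z (neg j)) (z' (neg j))))" for k
  \<comment> \<open>Bounds the factor from \<open>a k\<close> to \<open>a (Suc k)\<close>, because
    every denominator is at least \<open>1 - \<tau>\<^sup>2 * M\<^sup>2\<close>. Squaring the
    hypothesis on \<open>lam\<close> gives \<open>q < 1\<close>.\<close>
  define q where "q = lam\<^sup>2 / (1 - \<tau>\<^sup>2 * M\<^sup>2)"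
  have "lam\<^sup>2 < (sqrt (1 - \<tau>\<^sup>2 * M\<^sup>2))\<^sup>2"
    using par by (intro power_strict_mono) auto
  then have q: "0 \<le> q" "q < 1" using par(1) by (simp_all add: q_def)
  have a_Suc: "a (Suc k) = a k * (lam\<^sup>2 / (1 - \<tau>\<^sup>2 * inner (z (neg k)) (z' (neg k))))" for k
    by (simp add: a_def power2_eq_square)
  have a_le: "\<bar>a k\<bar> \<le> q ^ k" for k
  proof (induction k)
    case (Suc k)
    have "\<bar>lam\<^sup>2 / (1 - \<tau>\<^sup>2 * inner (z (neg k)) (z' (neg k)))\<bar> \<le> q"
      using bounded_inputs_inner_le[OF z z', of \<tau> "neg k" "neg k"] par(1)
      by (auto simp: q_def abs_divide intro!: divide_left_mono mult_pos_pos)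
    with Suc q have "\<bar>a (Suc k)\<bar> \<le> q ^ k * q"
      unfolding a_Suc abs_mult by (intro mult_mono) auto
    then show ?case by (simp add: mult.commute)
  qed (simp add: a_def)
  obtain B where B: "\<And>u u'. u \<in> bounded_inputs M \<Longrightarrow> u' \<in> bounded_inputs M \<Longrightarrow> \<bar>K u u'\<bar> \<le> B"
    using K(1) unfolding bounded_kernel_def by blast
  let ?R = "\<lambda>n. a n * K ((delay ^^ n) z) ((delay ^^ n) z')"
  \<comment> \<open>After \<open>n\<close> uses of the recursion, \<open>?R n\<close> is the
    remainder, with \<open>K\<close> taken at the inputs delayed \<open>n\<close> times.\<close>
  have unroll: "K z z' = (\<Sum>k<n. a k) + ?R n" for n
  proof (induction n)
    case 0
    show ?case by (simp add: a_def)
  next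
    case (Suc n)
    have "K ((delay ^^ n) z) ((delay ^^ n) z')
        = 1 + lam\<^sup>2 * K (delay ((delay ^^ n) z)) (delay ((delay ^^ n) z'))
            / (1 - \<tau>\<^sup>2 * inner (p0 ((delay ^^ n) z)) (p0 ((delay ^^ n) z')))"
      using K(2) funpow_delay_bounded_inputs[OF z] funpow_delay_bounded_inputs[OF z']
      unfolding volterra_recursion_def by blast
    then have "?R n = a n + ?R (Suc n)"
      by (simp add: a_Suc p0_funpow_delay distrib_left)
    with Suc show ?case by simp
  qed
  \<comment> \<open>Delayed inputs stay in the input set, so the same bound \<open>B\<close> serves
    for all \<open>n\<close> and the geometric decay of \<open>a\<close> prevails.\<close>
  have "?R \<longlonglongrightarrow> 0"
  proof (rule Lim_null_comparison)
    show "\<forall>\<^sub>F n in sequentially. norm (?R n) \<le> q ^ n * B"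
    proof (intro always_eventually allI)
      fix n
      show "norm (?R n) \<le> q ^ n * B"
        unfolding real_norm_def abs_mult using q(1)
        by (intro mult_mono a_le B funpow_delay_bounded_inputs z z') auto
    qed
    show "(\<lambda>n. q ^ n * B) \<longlonglongrightarrow> 0"
      using q by (intro tendsto_mult_left_zero LIMSEQ_realpow_zero)
  qed
  from tendsto_diff[OF tendsto_const[of "K z z'"] this]
  have "(\<lambda>n. K z z' - ?R n) \<longlonglongrightarrow> K z z'" by simp
  moreover have "K z z' - ?R n = (\<Sum>k<n. a k)" for n
    using unroll[of n] by simp
  ultimately have "a sums K z z'" by (simp add: sums_def)
  then have "(\<lambda>k. a (Suc k)) sums (K z z' - a 0)" by (simp add: sums_Suc_iff)
  then show ?thesis by (simp only: a_def) simp
qed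

theorem mainTheorem2:
  fixes M \<tau> lam :: real
  assumes "M > 0" and "\<tau> > 0" and "\<tau>\<^sup>2 * M\<^sup>2 < 1"
    and "0 < lam" and "lam < sqrt (1 - \<tau>\<^sup>2 * M\<^sup>2)"
  shows "(\<forall>z \<in> (bounded_inputs M :: (nonpos_int \<Rightarrow> real ^ 'd) set). \<exists>!x. volterra_system \<tau> lam z x)
    \<and> bounded_kernel M (volterra_kernel \<tau> lam :: (nonpos_int \<Rightarrow> real ^ 'd) \<Rightarrow> _)
    \<and> volterra_recursion M \<tau> lam (volterra_kernel \<tau> lam :: (nonpos_int \<Rightarrow> real ^ 'd) \<Rightarrow> _)
    \<and> (\<forall>F :: (nonpos_int \<Rightarrow> real ^ 'd) \<Rightarrow> (nonpos_int \<Rightarrow> real ^ 'd) \<Rightarrow> real.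
         bounded_kernel M F \<and> volterra_recursion M \<tau> lam F \<longrightarrow>
         (\<forall>z \<in> bounded_inputs M. \<forall>z' \<in> bounded_inputs M. F z z' = volterra_kernel \<tau> lam z z'))
    \<and> (\<forall>z \<in> bounded_inputs M. \<forall>z' \<in> (bounded_inputs M :: (nonpos_int \<Rightarrow> real ^ 'd) set).
         summable (\<lambda>k. lam ^ (2 * Suc k) *
           (\<Prod>j<Suc k. 1 / (1 - \<tau>\<^sup>2 * inner (z (neg j)) (z' (neg j))))) \<and>
         volterra_kernel \<tau> lam z z' = 1 + suminf (\<lambda>k. lam ^ (2 * Suc k) *
           (\<Prod>j<Suc k. 1 / (1 - \<tau>\<^sup>2 * inner (z (neg j)) (z' (neg j))))))"
proof (intro conjI allI ballI impI)
  note par = assms(3-5)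
  note K = volterra_kernel_bounded[OF par, where 'v = "real ^ 'd"]
    volterra_kernel_recursion[OF par, where 'v = "real ^ 'd"]
  show "\<exists>!x. volterra_system \<tau> lam z x" if "z \<in> bounded_inputs M" for z :: "nonpos_int \<Rightarrow> real ^ 'd"
    by (rule volterra_system_exists[OF that par]) (blast intro: volterra_system_unique)
  show "bounded_kernel M (volterra_kernel \<tau> lam :: (nonpos_int \<Rightarrow> real ^ 'd) \<Rightarrow> _)"
    "volterra_recursion M \<tau> lam (volterra_kernel \<tau> lam :: (nonpos_int \<Rightarrow> real ^ 'd) \<Rightarrow> _)"
    by (fact K)+
  fix z z' :: "nonpos_int \<Rightarrow> real ^ 'd"
  assume z: "z \<in> bounded_inputs M" and z': "z' \<in> bounded_inputs M"
  let ?f = "\<lambda>k. lam ^ (2 * Suc k) * (\<Prod>j<Suc k. 1 / (1 - \<tau>\<^sup>2 * inner (z (neg j)) (z' (neg j))))"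
  have sums: "?f sums (volterra_kernel \<tau> lam z z' - 1)"
    by (rule bounded_volterra_recursion_sums[OF par K z z'])
  then show "summable ?f" by (rule sums_summable)
  from sums_unique[OF sums] show "volterra_kernel \<tau> lam z z' = 1 + suminf ?f" by simp
  fix F :: "(nonpos_int \<Rightarrow> real ^ 'd) \<Rightarrow> (nonpos_int \<Rightarrow> real ^ 'd) \<Rightarrow> real"
  assume "bounded_kernel M F \<and> volterra_recursion M \<tau> lam F"
  \<comment> \<open>The series does not involve the kernel, so \<open>F\<close> and the Volterra
    kernel have the same sum.\<close>
  then have "?f sums (F z z' - 1)"
    by (intro bounded_volterra_recursion_sums[OF par _ _ z z']) auto
  from sums_unique2[OF this sums] show "F z z' = volterra_kernel \<tau> lam z z'" by simp
qed

end
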